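(* Let $\alpha\in(0,1)$, $\beta=\alpha$, $\theta=\alpha/2$. Assume that $a_k(\mathbf{x},t)>0$, that $a_k$ is $C^1$ in $t\in[0,T]$ for fixed $\mathbf{x}$ $(k=1,2)$, and that $|(a_1)_t/a_1|+|(a_2)_t/a_2|\le C_p$ on $\Omega\times[0,T]$ for a constant $C_p>0$. Then the numerical scheme $$(\mathcal{D}_\tau^\alpha u_h)^{n-\theta}=\mathcal{A}_h^{n-\theta}u_h^{n-\theta}+f_h^{n-\theta},\quad\mathbf{x}_h\in\Omega_h,\ 1\le n\le N;\qquad u_h^0=\varphi_h,\quad\mathbf{x}_h\in\Omega_h,$$ subject to zero boundary conditions, with $u_h^{n-\theta}:=(1-\theta)u_h^n+\theta u_h^{n-1}$, $f_h^{n-\theta}:=f(\mathbf{x}_h,t_{n-\theta})$, $\varphi_h:=\varphi(\mathbf{x}_h)$, is unconditionally stable, and the discrete solutions $u_h^n$ $(\mathbf{x}_h\in\Omega_h,\ 1\le n\le N)$ satisfy $$\|\nabla_hu^n\|\le C\Big(\|\nabla_hu^0\|+\max_{1\le k\le n}\sum_{j=1}^kP_{k-j}^{(k)}\|\nabla_hf^{j-\theta}\|\Big)\le C\Big(\|\nabla_hu^0\|+\max_{1\le k\le n}\big\{t_k^\alpha\|\nabla_hf^{k-\theta}\|\big\}\Big),$$ where $C>0$ is a generic constant (it may differ between the two bounds), independent of $n$, the time steps, $M_x$, $M_y$, $\varphi$ and $f$.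
   Context: Problem. $\Omega=(x_l,x_r)\times(y_l,y_r)$, $\mathbf{x}=(x,y)$, $T>0$. The scheme approximates $\mathcal{D}_t^\alpha u=\mathcal{A}u+f(\mathbf{x},t)$ in $\Omega\times(0,T]$, $u(\mathbf{x},0)=\varphi(\mathbf{x})$, $u=0$ on $\partial\Omega\times(0,T]$, with $\mathcal{D}_t^\alpha$ the Caputo derivative and $\mathcal{A}u=a_1\partial_{xx}^2u+a_2\partial_{yy}^2u+b_1\partial_xu+b_2\partial_yu+b_3u$, all coefficients being functions of $(\mathbf{x},t)$. Auxiliary functions. Let $d(\mathbf{x})$ be a positive and continuous function on $\Omega$ and set $p:=\dfrac{d(\mathbf{x})e^{-C_pt}}{a_1a_2}$, $p_1:=pa_1$, $p_2:=pa_2$, $p_3:=b_1-p^{-1}(p_1)_x$, $p_4:=b_2-p^{-1}(p_2)_y$. Standing assumptions: $a_1,a_2$ are $C^3$ in $\mathbf{x}\in\Omega$ for fixed $t$; $|b_l(\mathbf{x},t)|\le C_l$ for $l=1,2,3$ with positive constants $C_l$; and there are positive constants $\tilde C_l,\hat C_l$ with $\tilde C_0\le|p|\le\hat C_0$ and $\tilde C_l\le|p_l|\le\hat C_l$ for $l=1,2,3,4$ on $\Omega\times[0,T]$. Time mesh. $0=t_0<t_1<\cdots<t_N=T$, $\tau_k:=t_k-t_{k-1}$, $\rho_k:=\tau_k/\tau_{k+1}$ with $\max_k\rho_k\le7/4$; $t_{n-\theta}:=(1-\theta)t_n+\theta t_{n-1}$, $t_{k-\frac12}:=(t_{k-1}+t_k)/2$;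 $\omega_\mu(t):=t^{\mu-1}/\Gamma(\mu)$. Alikhanov formula. $a_{n-k}^{(n)}:=\frac1{\tau_k}\int_{t_{k-1}}^{\min\{t_k,t_{n-\theta}\}}\omega_{1-\beta}(t_{n-\theta}-s)\,ds$ $(1\le k\le n)$, $b_{n-k}^{(n)}:=\frac2{\tau_k(\tau_k+\tau_{k+1})}\int_{t_{k-1}}^{t_k}\omega_{1-\beta}(t_{n-\theta}-s)(s-t_{k-\frac12})\,ds$ $(1\le k\le n-1)$. $A_0^{(1)}:=a_0^{(1)}$; for $n\ge2$: $A_0^{(n)}:=a_0^{(n)}+\rho_{n-1}b_1^{(n)}$, $A_{n-k}^{(n)}:=a_{n-k}^{(n)}+\rho_{k-1}b_{n-k+1}^{(n)}-b_{n-k}^{(n)}$ $(2\le k\le n-1)$, $A_{n-1}^{(n)}:=a_{n-1}^{(n)}-b_{n-1}^{(n)}$. Then $(\mathcal{D}_\tau^\beta g)^{n-\theta}:=\sum_{k=1}^nA_{n-k}^{(n)}(g^k-g^{k-1})$. The discrete complementary convolution kernels $P_{n-j}^{(n)}$ are determined by $\sum_{j=k}^nP_{n-j}^{(n)}A_{j-k}^{(j)}=1$ for $1\le k\le n\le N$. Space mesh. $h_x=(x_r-x_l)/M_x$, $h_y=(y_r-y_l)/M_y$, $x_i=x_l+ih_x$, $y_j=y_l+jh_y$; $\Omega_h=\{(x_i,y_j):1\le i\le M_x-1,1\le j\le M_y-1\}$, $\mathbf{x}_h$ denotes a point of $\Omega_h$. $\delta_xu_{i+\frac12,j}:=(u_{i+1,j}-u_{i,j})/h_x$,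 $\delta_{\hat x}u_{i,j}:=(u_{i+1,j}-u_{i-1,j})/(2h_x)$, and $\delta_y,\delta_{\hat y}$ analogously. Writing $w_h^{n-\theta}$ for $w(\cdot,t_{n-\theta})$ evaluated at grid points for the coefficient functions (or at half-points for $p_1,p_2$ inside $\delta_x[\,\cdot\,]$, $\delta_y[\,\cdot\,]$), $$\mathcal{A}_h^{n-\theta}:=(p_h^{n-\theta})^{-1}\{\delta_x[(p_1)_h^{n-\theta}\delta_x]+\delta_y[(p_2)_h^{n-\theta}\delta_y]\}+(p_3)_h^{n-\theta}\delta_{\hat x}+(p_4)_h^{n-\theta}\delta_{\hat y}+(b_3)_h^{n-\theta},$$ where e.g. $\delta_x[p_1\delta_x]u_{i,j}=\frac1{h_x}\big((p_1)_{i+\frac12,j}\delta_xu_{i+\frac12,j}-(p_1)_{i-\frac12,j}\delta_xu_{i-\frac12,j}\big)$. Norms. For grid functions vanishing at boundary grid points (grid functions given on $\Omega_h$, such as $f_h^{n-\theta}$, being extended by zero): $\|\delta_xu\|^2=h_xh_y\sum_{i=0}^{M_x-1}\sum_{j=1}^{M_y-1}|\delta_xu_{i+\frac12,j}|^2$, $\|\delta_yu\|^2=h_xh_y\sum_{i=1}^{M_x-1}\sum_{j=0}^{M_y-1}|\delta_yu_{i,j+\frac12}|^2$, $\|\nabla_hu\|:=\sqrt{\|\delta_xu\|^2+\|\delta_yu\|^2}$.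
   Formalization: Stability and the first bound are proved only when all time steps are at most some τ₀>0 depending only on the problem data; without this they fail (e.g. one time step and a suitable large constant b_3 make the scheme singular). The second bound needs no restriction. *)

theory Defs
  imports "HOL-Analysis.Analysis"
begin

section \<open>Regularity\<close>

text \<open>
  \<open>Ck_on k g S\<close>: on the open set \<open>S\<close>, all partial derivatives of \<open>g\<close> up to order \<open>k\<close> exist and
  are continuous.
\<close>

fun Ck_on :: "nat \<Rightarrow> (real \<times> real \<Rightarrow> real) \<Rightarrow> (real \<times> real) set \<Rightarrow> bool" where
  "Ck_on 0 g S \<longleftrightarrow> continuous_on S g"
| "Ck_on (Suc k) g S \<longleftrightarrow> continuous_on S g \<and>
    (\<exists>gx gy.
      (\<forall>(x, y) \<in> S. ((\<lambda>s. g (s, y)) has_real_derivative gx (x, y)) (at x) \<and>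
                  ((\<lambda>s. g (x, s)) has_real_derivative gy (x, y)) (at y)) \<and>
      Ck_on k gx S \<and> Ck_on k gy S)"

text \<open>\<open>g\<close> is continuously differentiable on \<open>[0, T]\<close> with derivative \<open>g'\<close> (one-sided at the ends).\<close>

definition C1_time :: "real \<Rightarrow> (real \<Rightarrow> real) \<Rightarrow> (real \<Rightarrow> real) \<Rightarrow> bool" where
  "C1_time T g g' \<longleftrightarrow>
    (\<forall>s\<in>{0..T}. (g has_real_derivative g' s) (at s within {0..T})) \<and> continuous_on {0..T} g'"


section \<open>Time mesh and the Alikhanov formula\<close>

definition tau :: "(nat \<Rightarrow> real) \<Rightarrow> nat \<Rightarrow> real" where
  "tau t k = t k - t (k - 1)"

definition rho :: "(nat \<Rightarrow> real) \<Rightarrow> nat \<Rightarrow> real" where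
  "rho t k = tau t k / tau t (k + 1)"

definition time_mesh :: "real \<Rightarrow> nat \<Rightarrow> (nat \<Rightarrow> real) \<Rightarrow> bool" where
  "time_mesh T N t \<longleftrightarrow> N \<ge> 1 \<and> t 0 = 0 \<and> t N = T \<and> (\<forall>k<N. t k < t (k + 1)) \<and>
    (\<forall>k. 1 \<le> k \<and> k < N \<longrightarrow> rho t k \<le> 7 / 4)"

definition t_off :: "real \<Rightarrow> (nat \<Rightarrow> real) \<Rightarrow> nat \<Rightarrow> real" where
  "t_off \<theta> t n = (1 - \<theta>) * t n + \<theta> * t (n - 1)"

definition omega :: "real \<Rightarrow> real \<Rightarrow> real" where
  "omega \<mu> s = s powr (\<mu> - 1) / Gamma \<mu>"

text \<open>
  The kernels carry the indices of the formulas: \<open>alik_a \<beta> \<theta> t n m\<close> is \<open>a\<close> with superscript \<open>n\<close>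
  and subscript \<open>m = n - k\<close>, and likewise for \<open>alik_b\<close>, \<open>alik_A\<close> and the complementary kernels \<open>P\<close>.
\<close>

definition alik_a :: "real \<Rightarrow> real \<Rightarrow> (nat \<Rightarrow> real) \<Rightarrow> nat \<Rightarrow> nat \<Rightarrow> real" where
  "alik_a \<beta> \<theta> t n m = (let k = n - m in
     1 / tau t k *
       integral {t (k - 1) .. min (t k) (t_off \<theta> t n)} (\<lambda>s. omega (1 - \<beta>) (t_off \<theta> t n - s)))"

definition alik_b :: "real \<Rightarrow> real \<Rightarrow> (nat \<Rightarrow> real) \<Rightarrow> nat \<Rightarrow> nat \<Rightarrow> real" where
  "alik_b \<beta> \<theta> t n m = (let k = n - m in
     2 / (tau t k * (tau t k + tau t (k + 1))) *
       integral {t (k - 1) .. t k}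
         (\<lambda>s. omega (1 - \<beta>) (t_off \<theta> t n - s) * (s - (t (k - 1) + t k) / 2)))"

definition alik_A :: "real \<Rightarrow> real \<Rightarrow> (nat \<Rightarrow> real) \<Rightarrow> nat \<Rightarrow> nat \<Rightarrow> real" where
  "alik_A \<beta> \<theta> t n m =
    (if n = 1 then alik_a \<beta> \<theta> t n m
     else if m = 0 then alik_a \<beta> \<theta> t n 0 + rho t (n - 1) * alik_b \<beta> \<theta> t n 1
     else if m = n - 1 then alik_a \<beta> \<theta> t n m - alik_b \<beta> \<theta> t n m
     else alik_a \<beta> \<theta> t n m + rho t (n - m - 1) * alik_b \<beta> \<theta> t n (m + 1) - alik_b \<beta> \<theta> t n m)"

definition frac_diff :: "real \<Rightarrow> real \<Rightarrow> (nat \<Rightarrow> real) \<Rightarrow> (nat \<Rightarrow> real) \<Rightarrow> nat \<Rightarrow> real" where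
  "frac_diff \<beta> \<theta> t g n = (\<Sum>k=1..n. alik_A \<beta> \<theta> t n (n - k) * (g k - g (k - 1)))"

definition compl_kernels ::
  "real \<Rightarrow> real \<Rightarrow> nat \<Rightarrow> (nat \<Rightarrow> real) \<Rightarrow> (nat \<Rightarrow> nat \<Rightarrow> real) \<Rightarrow> bool" where
  "compl_kernels \<beta> \<theta> N t P \<longleftrightarrow>
    (\<forall>n k. 1 \<le> k \<and> k \<le> n \<and> n \<le> N \<longrightarrow>
      (\<Sum>j=k..n. P n (n - j) * alik_A \<beta> \<theta> t j (j - k)) = 1)"


section \<open>Space mesh and difference operators\<close>

text \<open>
  One-dimensional mesh with \<open>M\<close> cells on \<open>(l, r)\<close>. The index of a node is a real number so that
  \<open>node l r M (i + 1 / 2)\<close> is the half-point between the nodes \<open>i\<close> and \<open>i + 1\<close>.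
\<close>

definition mesh_h :: "real \<Rightarrow> real \<Rightarrow> nat \<Rightarrow> real" where
  "mesh_h l r M = (r - l) / real M"

definition node :: "real \<Rightarrow> real \<Rightarrow> nat \<Rightarrow> real \<Rightarrow> real" where
  "node l r M i = l + i * mesh_h l r M"

text \<open>Values of \<open>w\<close> on the interior grid points, extended by zero.\<close>

definition grid_fun ::
  "real \<Rightarrow> real \<Rightarrow> real \<Rightarrow> real \<Rightarrow> nat \<Rightarrow> nat \<Rightarrow> (real \<Rightarrow> real \<Rightarrow> real) \<Rightarrow> (nat \<Rightarrow> nat \<Rightarrow> real)" where
  "grid_fun xl xr yl yr Mx My w = (\<lambda>i j.
     if 1 \<le> i \<and> i < Mx \<and> 1 \<le> j \<and> j < My
     then w (node xl xr Mx (real i)) (node yl yr My (real j)) else 0)"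

text \<open>
  The discrete elliptic operator at the interior grid point \<open>(i, j)\<close>; the coefficients are functions
  of \<open>(x, y)\<close>, already evaluated in time.
\<close>

definition A_h ::
  "real \<Rightarrow> real \<Rightarrow> real \<Rightarrow> real \<Rightarrow> nat \<Rightarrow> nat \<Rightarrow>
   (real \<Rightarrow> real \<Rightarrow> real) \<Rightarrow> (real \<Rightarrow> real \<Rightarrow> real) \<Rightarrow> (real \<Rightarrow> real \<Rightarrow> real) \<Rightarrow>
   (real \<Rightarrow> real \<Rightarrow> real) \<Rightarrow> (real \<Rightarrow> real \<Rightarrow> real) \<Rightarrow> (real \<Rightarrow> real \<Rightarrow> real) \<Rightarrow>
   (nat \<Rightarrow> nat \<Rightarrow> real) \<Rightarrow> nat \<Rightarrow> nat \<Rightarrow> real" where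
  "A_h xl xr yl yr Mx My p p1 p2 p3 p4 b3 v i j =
    (let hx = mesh_h xl xr Mx; hy = mesh_h yl yr My;
         X = node xl xr Mx; Y = node yl yr My; x = X (real i); y = Y (real j)
     in inverse (p x y) *
          ((p1 (X (real i + 1 / 2)) y * ((v (i + 1) j - v i j) / hx)
            - p1 (X (real i - 1 / 2)) y * ((v i j - v (i - 1) j) / hx)) / hx
         + (p2 x (Y (real j + 1 / 2)) * ((v i (j + 1) - v i j) / hy)
            - p2 x (Y (real j - 1 / 2)) * ((v i j - v i (j - 1)) / hy)) / hy)
        + p3 x y * ((v (i + 1) j - v (i - 1) j) / (2 * hx))
        + p4 x y * ((v i (j + 1) - v i (j - 1)) / (2 * hy))
        + b3 x y * v i j)"

definition grad_norm ::
  "real \<Rightarrow> real \<Rightarrow> real \<Rightarrow> real \<Rightarrow> nat \<Rightarrow> nat \<Rightarrow> (nat \<Rightarrow> nat \<Rightarrow> real) \<Rightarrow> real" where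
  "grad_norm xl xr yl yr Mx My v =
    (let hx = mesh_h xl xr Mx; hy = mesh_h yl yr My
     in sqrt (hx * hy * (\<Sum>i=0..Mx - 1. \<Sum>j=1..My - 1. \<bar>(v (i + 1) j - v i j) / hx\<bar>\<^sup>2)
            + hx * hy * (\<Sum>i=1..Mx - 1. \<Sum>j=0..My - 1. \<bar>(v i (j + 1) - v i j) / hy\<bar>\<^sup>2)))"


section \<open>The scheme\<close>

text \<open>
  \<open>u n i j\<close> is the discrete solution at time level \<open>n\<close> and grid point \<open>(i, j)\<close>. The functions
  \<open>p\<close>, \<open>p1\<close>, \<open>p2\<close>, \<open>p3\<close>, \<open>p4\<close>, \<open>b3\<close> and \<open>f\<close> take the arguments \<open>x\<close>, \<open>y\<close> and time.
\<close>

definition scheme_solution ::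
  "real \<Rightarrow> real \<Rightarrow> real \<Rightarrow> real \<Rightarrow> real \<Rightarrow> real \<Rightarrow>
   (real \<Rightarrow> real \<Rightarrow> real \<Rightarrow> real) \<Rightarrow> (real \<Rightarrow> real \<Rightarrow> real \<Rightarrow> real) \<Rightarrow> (real \<Rightarrow> real \<Rightarrow> real \<Rightarrow> real) \<Rightarrow>
   (real \<Rightarrow> real \<Rightarrow> real \<Rightarrow> real) \<Rightarrow> (real \<Rightarrow> real \<Rightarrow> real \<Rightarrow> real) \<Rightarrow> (real \<Rightarrow> real \<Rightarrow> real \<Rightarrow> real) \<Rightarrow>
   nat \<Rightarrow> nat \<Rightarrow> nat \<Rightarrow> (nat \<Rightarrow> real) \<Rightarrow>
   (real \<Rightarrow> real \<Rightarrow> real) \<Rightarrow> (real \<Rightarrow> real \<Rightarrow> real \<Rightarrow> real) \<Rightarrow> (nat \<Rightarrow> nat \<Rightarrow> nat \<Rightarrow> real) \<Rightarrow> bool" where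
  "scheme_solution \<beta> \<theta> xl xr yl yr p p1 p2 p3 p4 b3 Mx My N t \<phi> f u \<longleftrightarrow>
    (\<forall>n i j. 1 \<le> n \<and> n \<le> N \<and> 1 \<le> i \<and> i < Mx \<and> 1 \<le> j \<and> j < My \<longrightarrow>
       frac_diff \<beta> \<theta> t (\<lambda>k. u k i j) n =
       (let s = t_off \<theta> t n in
         A_h xl xr yl yr Mx My (\<lambda>x y. p x y s) (\<lambda>x y. p1 x y s) (\<lambda>x y. p2 x y s)
           (\<lambda>x y. p3 x y s) (\<lambda>x y. p4 x y s) (\<lambda>x y. b3 x y s)
           (\<lambda>i j. (1 - \<theta>) * u n i j + \<theta> * u (n - 1) i j) i j
         + f (node xl xr Mx (real i)) (node yl yr My (real j)) s)) \<and>
    (\<forall>i j. 1 \<le> i \<and> i < Mx \<and> 1 \<le> j \<and> j < My \<longrightarrow>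
       u 0 i j = \<phi> (node xl xr Mx (real i)) (node yl yr My (real j))) \<and>
    (\<forall>n i j. n \<le> N \<and> i \<le> Mx \<and> j \<le> My \<and> (i = 0 \<or> i = Mx \<or> j = 0 \<or> j = My) \<longrightarrow> u n i j = 0)"

text \<open>
  Stability of the scheme: for two solutions on the same mesh, the difference depends Lipschitz
  continuously on the initial data and the source term, uniformly in all meshes. It is unconditional
  in the usual sense that nothing relates the time steps to the space steps: \<open>\<tau>\<^sub>0\<close> bounds the time
  steps alone. Some such bound is needed: for time-independent \<open>A_h\<close>, the first step of the scheme
  is singular if \<open>A_h\<close> has an eigenvalue \<open>\<lambda>\<close> with \<open>(1 - \<theta>) * \<lambda> = alik_A \<beta> \<theta> t 1 0\<close>, which
  happens for suitable \<open>b3 > 0\<close>.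
\<close>

definition unconditionally_stable ::
  "real \<Rightarrow> real \<Rightarrow> real \<Rightarrow> real \<Rightarrow> real \<Rightarrow> real \<Rightarrow> real \<Rightarrow>
   (real \<Rightarrow> real \<Rightarrow> real \<Rightarrow> real) \<Rightarrow> (real \<Rightarrow> real \<Rightarrow> real \<Rightarrow> real) \<Rightarrow> (real \<Rightarrow> real \<Rightarrow> real \<Rightarrow> real) \<Rightarrow>
   (real \<Rightarrow> real \<Rightarrow> real \<Rightarrow> real) \<Rightarrow> (real \<Rightarrow> real \<Rightarrow> real \<Rightarrow> real) \<Rightarrow> (real \<Rightarrow> real \<Rightarrow> real \<Rightarrow> real) \<Rightarrow>
   real \<Rightarrow> bool" where
  "unconditionally_stable \<beta> \<theta> xl xr yl yr T p p1 p2 p3 p4 b3 \<tau>\<^sub>0 \<longleftrightarrow>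
    (\<exists>C>0. \<forall>Mx My N t \<phi> \<psi> f g u v.
       1 \<le> Mx \<and> 1 \<le> My \<and> time_mesh T N t \<and> (\<forall>k\<in>{1..N}. tau t k \<le> \<tau>\<^sub>0) \<and>
       scheme_solution \<beta> \<theta> xl xr yl yr p p1 p2 p3 p4 b3 Mx My N t \<phi> f u \<and>
       scheme_solution \<beta> \<theta> xl xr yl yr p p1 p2 p3 p4 b3 Mx My N t \<psi> g v \<longrightarrow>
       (\<forall>n\<in>{1..N}.
          grad_norm xl xr yl yr Mx My (\<lambda>i j. u n i j - v n i j)
          \<le> C * (grad_norm xl xr yl yr Mx My (\<lambda>i j. u 0 i j - v 0 i j) +
              Max ((\<lambda>k. t k powr \<beta> * grad_norm xl xr yl yr Mx My
                (grid_fun xl xr yl yr Mx My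
                  (\<lambda>x y. f x y (t_off \<theta> t k) - g x y (t_off \<theta> t k)))) ` {1..n}))))"

end

theory Submission
  imports Defs
begin

text \<open>
  The proof is a discrete energy argument in the gradient norm, closed by a discrete fractional
  Gronwall inequality.

  \<^emph>\<open>Kernels.\<close> With \<open>\<theta> = \<alpha> / 2\<close> and \<open>W s = omega (1 - \<alpha>) (\<sigma> n - s)\<close>, where \<open>\<sigma> n\<close> is the off-set time
  \<open>t_off \<theta> t n\<close>, the Alikhanov kernels \<open>A n k\<close> (the coefficient of the increment on cell \<open>k\<close>) satisfy
  \<open>W (t (k - 1)) \<le> A n k\<close>, and \<open>A n k \<le> W (t k)\<close> for \<open>k < n\<close>; the latter needs
  \<open>\<rho> ^ 3 \<le> 3 * (1 + \<rho>)\<close> for the step ratios \<open>\<rho>\<close>, which \<open>\<rho> \<le> 7 / 4\<close> guarantees. Hence the kernels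
  increase in \<open>k\<close>, and since \<open>(1 - \<alpha>) * a n = (1 - \<alpha> / 2) * W (t (n - 1))\<close> exactly for the local part
  \<open>a n\<close> of the last kernel, \<open>(1 - \<alpha> / 2) * A n (n - 1) \<le> (1 - \<alpha>) * A n n\<close>. This is what makes the
  difference operator satisfy the energy inequality \<open>D (v\<^sup>2) n \<le> 2 * D v n * v\<^sub>\<theta>\<close> with
  \<open>v\<^sub>\<theta> = (1 - \<theta>) * v n + \<theta> * v (n - 1)\<close>, and it makes the complementary kernels nonnegative.

  \<^emph>\<open>Space.\<close> Multiplying the scheme by minus the principal part \<open>L\<close> of the elliptic operator
  and summing by parts moves one difference quotient onto each of \<open>D u\<close> and \<open>f\<close>. The factor \<open>1 / p\<close>
  turns up as \<open>- L\<^sup>2 / p\<close>, which absorbs the lower-order terms, up to a multiple of the squared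
  gradient norm, by Young's and Poincare's inequalities. The weights \<open>p1 = d * exp (- Cp * s) / a2\<close> and
  \<open>p2 = d * exp (- Cp * s) / a1\<close> decrease in time by the choice of \<open>Cp\<close>, so they may be
  moved inside \<open>D\<close>. This gives \<open>D V n \<le> \<lambda> * (V n + V (n - 1)) + \<dots>\<close> for the weighted energy \<open>V\<close>.

  \<^emph>\<open>Gronwall.\<close> Convolving with the complementary kernels inverts \<open>D\<close>. If the time steps are at most
  \<open>1 / (2 * \<mu>)\<close>, comparing with the function \<open>(\<mu> * s) powr \<alpha> + exp (\<mu> * s)\<close> shows that the convolution maps
  \<open>exp (\<mu> * t n)\<close> to at most \<open>6 * Gamma (1 - \<alpha>) * \<mu> powr - \<alpha> * exp (\<mu> * t n)\<close>. For large \<open>\<mu>\<close> the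
  factor is small, and the maximum of \<open>exp (- \<mu> * t k) * V k\<close> can be absorbed. The second bound of
  the theorem follows from \<open>A j 1 \<ge> omega (1 - \<alpha>) (t j)\<close>, which bounds the convolution of
  \<open>t j powr - \<alpha>\<close> by \<open>Gamma (1 - \<alpha>)\<close>.
\<close>

section \<open>Moments of monotone functions on an interval\<close>

lemma integral_sub_mid: "integral {p..q} (\<lambda>s. s - (p + q) / 2) = (0::real)" if "p \<le> q" for p q :: real
proof -
  have "((\<lambda>s. s - (p + q) / 2) has_integral ((q - (p+q)/2)^2/2 - (p - (p+q)/2)^2/2)) {p..q}"
    by (rule fundamental_theorem_of_calculus[OF that])
       (auto intro!: derivative_eq_intros simp flip: has_real_derivative_iff_has_vector_derivative)
  from integral_unique[OF this] show ?thesis by (simp add: field_simps power2_eq_square)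
qed

lemma integral_sub_mid_sq:
  "integral {p..q} (\<lambda>s. (s - (p + q) / 2)\<^sup>2) = (q - p) ^ 3 / 12" if "p \<le> q" for p q :: real
proof -
  have "((\<lambda>s. (s - (p + q) / 2)\<^sup>2) has_integral ((q - (p+q)/2)^3/3 - (p - (p+q)/2)^3/3)) {p..q}"
    by (rule fundamental_theorem_of_calculus[OF that])
       (auto intro!: derivative_eq_intros simp flip: has_real_derivative_iff_has_vector_derivative)
  from integral_unique[OF this] show ?thesis by (simp only:) (simp add: field_simps power3_eq_cube)
qed

lemma centred_moment_nonneg:
  fixes W :: "real \<Rightarrow> real"
  assumes "p \<le> q" and W: "continuous_on {p..q} W" and mono: "mono_on {p..q} W"
  shows "0 \<le> integral {p..q} (\<lambda>s. W s * (s - (p + q) / 2))"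
proof -
  let ?m = "(p + q) / 2"
  have m: "?m \<in> {p..q}" using assms(1) by auto
  have "integral {p..q} (\<lambda>s. W ?m * (s - ?m)) \<le> integral {p..q} (\<lambda>s. W s * (s - ?m))"
  proof (rule integral_le)
    show "W ?m * (s - ?m) \<le> W s * (s - ?m)" if s: "s \<in> {p..q}" for s
    proof (cases "s \<le> ?m")
      case True
      with s m have "W s \<le> W ?m" using mono_onD[OF mono] by blast
      with True show ?thesis by (intro mult_right_mono_neg) auto
    next
      case False
      with s m have "W ?m \<le> W s" using mono_onD[OF mono, of ?m s] by auto
      with False show ?thesis by (intro mult_right_mono) auto
    qed
  qed (intro integrable_continuous_real continuous_intros W)+
  also have "integral {p..q} (\<lambda>s. W ?m * (s - ?m)) = W ?m * integral {p..q} (\<lambda>s. s - ?m)"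
    by (rule integral_mult_right)
  finally show ?thesis using integral_sub_mid[OF assms(1)] by simp
qed

lemma centred_moment_le:
  fixes W :: "real \<Rightarrow> real"
  assumes "p \<le> q" and W: "continuous_on {p..q} W"
    and slope: "\<And>s r. p \<le> s \<Longrightarrow> s \<le> r \<Longrightarrow> r \<le> q \<Longrightarrow> W r - W s \<le> D * (r - s)"
  shows "integral {p..q} (\<lambda>s. W s * (s - (p + q) / 2)) \<le> D * (q - p) ^ 3 / 12"
proof -
  define m where m_def: "m = (p + q) / 2"
  have m: "m \<in> {p..q}" using assms(1) by (auto simp: m_def)
  have "integral {p..q} (\<lambda>s. W s * (s - m)) \<le> integral {p..q} (\<lambda>s. W m * (s - m) + D * (s - m)\<^sup>2)"
  proof (rule integral_le)
    show "W s * (s - m) \<le> W m * (s - m) + D * (s - m)\<^sup>2" if s: "s \<in> {p..q}" for s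
    proof (cases "s \<le> m")
      case True
      with s m slope[of s m] have "W m - D * (m - s) \<le> W s" by auto
      with True have "W s * (s - m) \<le> (W m - D * (m - s)) * (s - m)"
        by (intro mult_right_mono_neg) auto
      then show ?thesis by (simp add: power2_eq_square algebra_simps)
    next
      case False
      with s m slope[of m s] have "W s \<le> W m + D * (s - m)" by auto
      with False have "W s * (s - m) \<le> (W m + D * (s - m)) * (s - m)"
        by (intro mult_right_mono) auto
      then show ?thesis by (simp add: power2_eq_square algebra_simps)
    qed
  qed (intro integrable_continuous_real continuous_intros W)+
  also have "\<dots> = W m * integral {p..q} (\<lambda>s. s - m) + D * integral {p..q} (\<lambda>s. (s - m)\<^sup>2)"
    by (subst integral_add) (auto intro!: integrable_continuous_real continuous_intros)
  finally show ?thesis using integral_sub_mid[OF assms(1)] integral_sub_mid_sq[OF assms(1)] by (simp add: m_def)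
qed

lemma mean_le:
  fixes W :: "real \<Rightarrow> real"
  assumes "p \<le> q" and W: "continuous_on {p..q} W"
    and slope: "\<And>s. p \<le> s \<Longrightarrow> s \<le> q \<Longrightarrow> D * (q - s) \<le> W q - W s"
  shows "integral {p..q} W \<le> W q * (q - p) - D * (q - p)\<^sup>2 / 2"
proof -
  let ?m = "(p + q) / 2"
  have "integral {p..q} W \<le> integral {p..q} (\<lambda>s. (W q - D * (q - p) / 2) + D * (s - ?m))"
  proof (rule integral_le)
    show "W s \<le> (W q - D * (q - p) / 2) + D * (s - ?m)" if "s \<in> {p..q}" for s
    proof -
      have "D * (q - s) = D * (q - p) / 2 - D * (s - ?m)" by (simp add: field_simps)
      with slope[of s] that show ?thesis by auto
    qed
  qed (intro integrable_continuous_real continuous_intros W)+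
  also have "\<dots> = integral {p..q} (\<lambda>s. W q - D * (q - p) / 2) + D * integral {p..q} (\<lambda>s. s - ?m)"
    by (subst integral_add) (auto intro!: integrable_continuous_real continuous_intros)
  also have "\<dots> = W q * (q - p) - D * (q - p)\<^sup>2 / 2"
    using assms(1) integral_sub_mid[OF assms(1)] by (simp add: power2_eq_square field_simps)
  finally show ?thesis .
qed

text \<open>
  The function \<open>1 - 2 / (q - p + r) * (s - (p + q) / 2)\<close> is nonnegative on \<open>[p, q]\<close> and has mean \<open>1\<close>.
\<close>

lemma tilted_mean_ge:
  fixes W :: "real \<Rightarrow> real"
  assumes "p < q" "0 \<le> r" and W: "continuous_on {p..q} W"
    and low: "\<And>s. p \<le> s \<Longrightarrow> s \<le> q \<Longrightarrow> w \<le> W s"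
  shows "w \<le> 1 / (q - p) * integral {p..q} W
      - 2 / ((q - p) * (q - p + r)) * integral {p..q} (\<lambda>s. W s * (s - (p + q) / 2))"
proof -
  define m c where m_def: "m = (p + q) / 2" and c_def: "c = 2 / (q - p + r)"
  have pos: "0 \<le> 1 - c * (s - m)" if "s \<in> {p..q}" for s
    using that assms(1,2) by (simp add: m_def c_def field_simps)
  have "integral {p..q} (\<lambda>s. w - w * c * (s - m)) \<le> integral {p..q} (\<lambda>s. W s - c * (W s * (s - m)))"
  proof (rule integral_le)
    show "w - w * c * (s - m) \<le> W s - c * (W s * (s - m))" if s: "s \<in> {p..q}" for s
    proof -
      have "w * (1 - c * (s - m)) \<le> W s * (1 - c * (s - m))"
        using low[of s] s pos[OF s] by (intro mult_right_mono) auto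
      then show ?thesis by (simp add: algebra_simps)
    qed
  qed (intro integrable_continuous_real continuous_intros W)+
  also have "\<dots> = integral {p..q} W - c * integral {p..q} (\<lambda>s. W s * (s - m))"
    by (subst integral_diff) (auto intro!: integrable_continuous_real continuous_intros W)
  also have "integral {p..q} (\<lambda>s. w - w * c * (s - m))
      = integral {p..q} (\<lambda>s. w) - w * c * integral {p..q} (\<lambda>s. s - m)"
    by (subst integral_diff) (auto intro!: integrable_continuous_real continuous_intros)
  also have "\<dots> = w * (q - p)"
    using assms(1) integral_sub_mid[of p q] by (simp add: m_def)
  finally have "w * (q - p) / (q - p) \<le> (integral {p..q} W - c * integral {p..q} (\<lambda>s. W s * (s - m))) / (q - p)"
    using assms(1) by (intro divide_right_mono) auto
  then show ?thesis using assms(1,2) unfolding m_def c_def by (simp add: diff_divide_distrib mult.commute)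
qed

section \<open>The Alikhanov kernels\<close>

lemma omega_pos: "\<lbrakk>\<mu> > 0; r > 0\<rbrakk> \<Longrightarrow> omega \<mu> r > 0"
  by (simp add: omega_def Gamma_real_pos)

lemma omega_antimono: "omega \<mu> s \<le> omega \<mu> r" if "0 < \<mu>" "\<mu> < 1" "0 < r" "r \<le> s"
  using that by (auto simp: omega_def Gamma_real_pos intro!: divide_right_mono powr_mono2')

text \<open>The negative derivative of \<open>omega \<mu>\<close>, itself positive and decreasing for \<open>0 < \<mu> < 1\<close>.\<close>

definition omega_slope :: "real \<Rightarrow> real \<Rightarrow> real" where
  "omega_slope \<mu> r = (1 - \<mu>) * r powr (\<mu> - 2) / Gamma \<mu>"

lemma omega_diff_bounds:
  assumes \<mu>: "0 < \<mu>" "\<mu> < 1" and r: "0 < r" "r \<le> s"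
  shows "omega_slope \<mu> s * (s - r) \<le> omega \<mu> r - omega \<mu> s"
    and "omega \<mu> r - omega \<mu> s \<le> omega_slope \<mu> r * (s - r)"
proof -
  have "omega_slope \<mu> s * (s - r) \<le> omega \<mu> r - omega \<mu> s \<and>
        omega \<mu> r - omega \<mu> s \<le> omega_slope \<mu> r * (s - r)"
  proof (cases "r = s")
    case False
    have "\<exists>z>r. z < s \<and> omega \<mu> s - omega \<mu> r = (s - r) * (- omega_slope \<mu> z)"
    proof (rule MVT2)
      show "(omega \<mu> has_real_derivative - omega_slope \<mu> z) (at z)" if "r \<le> z" "z \<le> s" for z
      proof -
        have "Gamma \<mu> > 0" using \<mu> by (simp add: Gamma_real_pos)
        then show ?thesis
          unfolding omega_def[abs_def] omega_slope_def using that r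
          by (auto intro!: derivative_eq_intros simp: field_simps)
      qed
    qed (use r False in auto)
    then obtain z where z: "r < z" "z < s" "omega \<mu> r - omega \<mu> s = omega_slope \<mu> z * (s - r)"
      by (auto simp: algebra_simps)
    have "omega_slope \<mu> s \<le> omega_slope \<mu> z" "omega_slope \<mu> z \<le> omega_slope \<mu> r"
      using z r \<mu> unfolding omega_slope_def
      by (auto intro!: divide_right_mono mult_left_mono powr_mono2' simp: Gamma_real_pos)
    with z r show ?thesis by (simp add: mult_right_mono)
  qed auto
  then show "omega_slope \<mu> s * (s - r) \<le> omega \<mu> r - omega \<mu> s"
    and "omega \<mu> r - omega \<mu> s \<le> omega_slope \<mu> r * (s - r)" by auto
qed

lemma omega_slope_nonneg: "0 < \<mu> \<Longrightarrow> \<mu> < 1 \<Longrightarrow> 0 \<le> omega_slope \<mu> r"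
  by (simp add: omega_slope_def Gamma_real_pos)

lemma integral_omega:
  assumes "0 < \<mu>" "\<mu> < 1" "p < q"
  shows "integral {p..q} (\<lambda>s. omega \<mu> (q - s)) = (q - p) * omega \<mu> (q - p) / \<mu>"
proof -
  have G: "Gamma \<mu> \<noteq> 0" using assms Gamma_real_pos[of \<mu>] by linarith
  have "((\<lambda>s. omega \<mu> (q - s)) has_integral
      - ((q - q) powr \<mu> / (\<mu> * Gamma \<mu>)) - - ((q - p) powr \<mu> / (\<mu> * Gamma \<mu>))) {p..q}"
  proof (rule fundamental_theorem_of_calculus_interior)
    show "continuous_on {p..q} (\<lambda>s. - ((q - s) powr \<mu> / (\<mu> * Gamma \<mu>)))"
      using assms G
      by (intro continuous_on_minus continuous_on_divide continuous_on_powr' continuous_intros) auto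
    show "((\<lambda>s. - ((q - s) powr \<mu> / (\<mu> * Gamma \<mu>))) has_vector_derivative omega \<mu> (q - s)) (at s)"
      if "s \<in> {p<..<q}" for s
      unfolding omega_def has_real_derivative_iff_has_vector_derivative[symmetric]
      using that assms G by (auto intro!: derivative_eq_intros simp: field_simps)
  qed (use assms in auto)
  from integral_unique[OF this]
  have "integral {p..q} (\<lambda>s. omega \<mu> (q - s)) = (q - p) powr \<mu> / (\<mu> * Gamma \<mu>)" by simp
  also have "\<dots> = (q - p) * omega \<mu> (q - p) / \<mu>"
    using powr_mult_base[of "q - p" "\<mu> - 1"] assms by (simp add: omega_def)
  finally show ?thesis .
qed

text \<open>
  A graded time mesh with the off-set \<open>\<theta> = \<alpha> / 2\<close>. In \<open>A n k\<close> the second index is the cell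
  \<open>[t (k - 1), t k]\<close>, not the distance \<open>n - k\<close>; thus \<open>A n k\<close> multiplies the increment on that cell.
\<close>

locale alikhanov_mesh =
  fixes \<alpha> T :: real and N :: nat and t :: "nat \<Rightarrow> real"
  assumes \<alpha>: "0 < \<alpha>" "\<alpha> < 1" and mesh: "time_mesh T N t"
begin

abbreviation \<sigma> :: "nat \<Rightarrow> real" where "\<sigma> n \<equiv> t_off (\<alpha> / 2) t n"

abbreviation A :: "nat \<Rightarrow> nat \<Rightarrow> real" where "A n k \<equiv> alik_A \<alpha> (\<alpha> / 2) t n (n - k)"

lemma t_less: "i < j \<Longrightarrow> j \<le> N \<Longrightarrow> t i < t j"
proof (induction j)
  case (Suc j)
  then have "t j < t (Suc j)" using mesh by (auto simp: time_mesh_def)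
  with Suc show ?case by (cases "i = j") auto
qed auto

lemma t_le: "i \<le> j \<Longrightarrow> j \<le> N \<Longrightarrow> t i \<le> t j"
  using t_less[of i j] by (cases "i = j") auto

lemma t_0 [simp]: "t 0 = 0" and t_N: "t N = T"
  using mesh by (auto simp: time_mesh_def)

lemma tau_pos: "1 \<le> k \<Longrightarrow> k \<le> N \<Longrightarrow> tau t k > 0"
  using t_less[of "k - 1" k] by (simp add: tau_def)

lemma rho_le: "1 \<le> k \<Longrightarrow> k < N \<Longrightarrow> rho t k \<le> 7 / 4"
  using mesh by (auto simp: time_mesh_def)

lemma rho_pos: "1 \<le> k \<Longrightarrow> k < N \<Longrightarrow> rho t k > 0"
  using tau_pos[of k] tau_pos[of "k + 1"] by (simp add: rho_def)

lemma sigma_eq: "1 \<le> n \<Longrightarrow> \<sigma> n = t (n - 1) + (1 - \<alpha> / 2) * tau t n"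
  by (simp add: t_off_def tau_def algebra_simps)

lemma sigma_bounds:
  assumes "1 \<le> n" "n \<le> N" shows "t (n - 1) < \<sigma> n" "\<sigma> n < t n"
proof -
  have "t n - \<sigma> n = \<alpha> / 2 * tau t n"
    unfolding t_off_def tau_def using assms by (simp add: field_simps)
  moreover have "0 < \<alpha> * tau t n" "\<alpha> * tau t n < 1 * tau t n"
    using tau_pos[OF assms] \<alpha> by (simp_all add: mult_strict_right_mono)
  ultimately show "\<sigma> n < t n" "t (n - 1) < \<sigma> n"
    by (auto simp: tau_def)
qed

end

text \<open>
  The kernel \<open>omega (1 - \<alpha>) (\<sigma> - s)\<close> on one cell \<open>[p, q]\<close> of the time mesh that ends before \<open>\<sigma>\<close>.
\<close>

locale kernel_cell =
  fixes \<alpha> \<sigma> p q :: real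
  assumes \<alpha>: "0 < \<alpha>" "\<alpha> < 1" and cell: "p < q" "q < \<sigma>"
begin

abbreviation W :: "real \<Rightarrow> real" where "W s \<equiv> omega (1 - \<alpha>) (\<sigma> - s)"

lemma W_cont: "continuous_on {p..q} W"
proof -
  have "Gamma (1 - \<alpha>) \<noteq> 0" using \<alpha> Gamma_real_pos[of "1 - \<alpha>"] by linarith
  then show ?thesis unfolding omega_def using cell by (intro continuous_intros) auto
qed

lemma W_mono: "s \<le> r \<Longrightarrow> r \<le> q \<Longrightarrow> W s \<le> W r"
  using \<alpha> cell by (intro omega_antimono) auto

lemma moment_nonneg: "0 \<le> integral {p..q} (\<lambda>s. W s * (s - (p + q) / 2))"
  using cell W_cont W_mono by (intro centred_moment_nonneg) (auto intro!: mono_onI)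

lemma moment_le:
  "integral {p..q} (\<lambda>s. W s * (s - (p + q) / 2)) \<le> omega_slope (1 - \<alpha>) (\<sigma> - q) * (q - p) ^ 3 / 12"
proof (rule centred_moment_le[OF _ W_cont])
  show "W r - W s \<le> omega_slope (1 - \<alpha>) (\<sigma> - q) * (r - s)" if "p \<le> s" "s \<le> r" "r \<le> q" for s r
  proof -
    have "W r - W s \<le> omega_slope (1 - \<alpha>) (\<sigma> - r) * (r - s)"
      using omega_diff_bounds(2)[of "1 - \<alpha>" "\<sigma> - r" "\<sigma> - s"] that \<alpha> cell by simp
    also have "\<dots> \<le> omega_slope (1 - \<alpha>) (\<sigma> - q) * (r - s)"
      unfolding omega_slope_def using that \<alpha> cell
      by (intro mult_right_mono divide_right_mono mult_left_mono powr_mono2') (auto simp: Gamma_real_pos less_imp_le)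
    finally show ?thesis .
  qed
qed (use cell in auto)

lemma integral_le:
  "integral {p..q} W \<le> W q * (q - p) - omega_slope (1 - \<alpha>) (\<sigma> - p) * (q - p)\<^sup>2 / 2"
proof (rule mean_le[OF _ W_cont])
  show "omega_slope (1 - \<alpha>) (\<sigma> - p) * (q - s) \<le> W q - W s" if "p \<le> s" "s \<le> q" for s
  proof -
    have "omega_slope (1 - \<alpha>) (\<sigma> - p) * (q - s) \<le> omega_slope (1 - \<alpha>) (\<sigma> - s) * (q - s)"
      unfolding omega_slope_def using that \<alpha> cell
      by (intro mult_right_mono divide_right_mono mult_left_mono powr_mono2') (auto simp: Gamma_real_pos less_imp_le)
    also have "\<dots> \<le> W q - W s"
      using omega_diff_bounds(1)[of "1 - \<alpha>" "\<sigma> - q" "\<sigma> - s"] that \<alpha> cell by simp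
    finally show ?thesis .
  qed
qed (use cell in auto)

lemma tilted_mean:
  "0 \<le> r \<Longrightarrow> W p \<le> 1 / (q - p) * integral {p..q} W
      - 2 / ((q - p) * (q - p + r)) * integral {p..q} (\<lambda>s. W s * (s - (p + q) / 2))"
  using cell W_cont W_mono by (intro tilted_mean_ge) auto

end

context alikhanov_mesh
begin

text \<open>
  The kernels \<open>a\<close> and \<open>b\<close>, indexed by the cell \<open>k\<close>. Setting \<open>b' n k = 0\<close> for \<open>k = 0\<close> and \<open>k = n\<close> merges the
  case distinction in the definition of \<open>alik_A\<close> into the single formula \<open>A_eq\<close>.
\<close>

definition a' :: "nat \<Rightarrow> nat \<Rightarrow> real" where "a' n k = alik_a \<alpha> (\<alpha> / 2) t n (n - k)"

definition b' :: "nat \<Rightarrow> nat \<Rightarrow> real" where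
  "b' n k = (if 1 \<le> k \<and> k < n then alik_b \<alpha> (\<alpha> / 2) t n (n - k) else 0)"

lemma A_eq: "A n k = a' n k + rho t (k - 1) * b' n (k - 1) - b' n k" if "1 \<le> k" "k \<le> n"
proof -
  have "n - k + 1 = n - (k - 1)" "n - (n - k) - 1 = k - 1" using that by auto
  then show ?thesis using that
    by (auto simp: alik_A_def a'_def b'_def)
qed

lemma cell_ok: "kernel_cell \<alpha> (\<sigma> n) (t (k - 1)) (t k)" if "1 \<le> k" "k < n" "n \<le> N"
proof
  show "t (k - 1) < t k" using that by (intro t_less) auto
  have "t k \<le> t (n - 1)" using that by (intro t_le) auto
  also have "\<dots> < \<sigma> n" using that by (intro sigma_bounds) auto
  finally show "t k < \<sigma> n" .
qed (use \<alpha> in auto)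

lemma a'_eq: "a' n k = 1 / (t k - t (k - 1)) *
    integral {t (k - 1)..t k} (\<lambda>s. omega (1 - \<alpha>) (\<sigma> n - s))" if "1 \<le> k" "k < n" "n \<le> N"
  using kernel_cell.cell[OF cell_ok[OF that]] that by (simp add: a'_def alik_a_def Let_def tau_def)

lemma b'_eq: "b' n k = 2 / ((t k - t (k - 1)) * (t k - t (k - 1) + tau t (k + 1))) *
    integral {t (k - 1)..t k} (\<lambda>s. omega (1 - \<alpha>) (\<sigma> n - s) * (s - (t (k - 1) + t k) / 2))"
  if "1 \<le> k" "k < n" "n \<le> N"
  using that by (simp add: b'_def alik_b_def Let_def tau_def)

lemma b'_nonneg: "0 \<le> b' n k" if "n \<le> N"
proof (cases "1 \<le> k \<and> k < n")
  case True
  then have "0 \<le> t k - t (k - 1)" "0 \<le> tau t (k + 1)"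
    using tau_pos[of k] tau_pos[of "k + 1"] that by (auto simp: tau_def)
  then show ?thesis
    using True that kernel_cell.moment_nonneg[OF cell_ok[of k n]] by (subst b'_eq) auto
qed (auto simp: b'_def)

lemma a'_last: "a' n n = (1 - \<alpha> / 2) / (1 - \<alpha>) * omega (1 - \<alpha>) (\<sigma> n - t (n - 1))" if "1 \<le> n" "n \<le> N"
proof -
  have s: "t (n - 1) < \<sigma> n" "\<sigma> n < t n" using sigma_bounds that by auto
  have "a' n n = 1 / tau t n * ((\<sigma> n - t (n - 1)) * omega (1 - \<alpha>) (\<sigma> n - t (n - 1)) / (1 - \<alpha>))"
    using s \<alpha> integral_omega[of "1 - \<alpha>" "t (n - 1)" "\<sigma> n"] by (simp add: a'_def alik_a_def Let_def)
  also have "\<dots> = 1 / tau t n * ((1 - \<alpha> / 2) * tau t n * omega (1 - \<alpha>) (\<sigma> n - t (n - 1)) / (1 - \<alpha>))"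
    using sigma_eq that by simp
  finally show ?thesis using tau_pos[of n] that by simp
qed

text \<open>
  The term with \<open>rho\<close> is nonnegative. For \<open>k < n\<close>, \<open>a' - b'\<close> is a weighted mean of the increasing
  kernel over the cell; for \<open>k = n\<close>, it is the value at \<open>t (n - 1)\<close> times a factor of at least \<open>1\<close>.
\<close>

lemma A_ge: "omega (1 - \<alpha>) (\<sigma> n - t (k - 1)) \<le> A n k" if k: "1 \<le> k" "k \<le> n" "n \<le> N"
proof -
  have "0 \<le> rho t (k - 1) * b' n (k - 1)"
    using b'_nonneg[of n "k - 1"] rho_pos[of "k - 1"] k
    by (cases "k = 1") (auto simp: b'_def intro!: mult_nonneg_nonneg)
  moreover have "omega (1 - \<alpha>) (\<sigma> n - t (k - 1)) \<le> a' n k - b' n k"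
  proof (cases "k < n")
    case True
    then have "0 \<le> tau t (k + 1)" using tau_pos[of "k + 1"] k by auto
    from kernel_cell.tilted_mean[OF cell_ok[OF k(1) True k(3)] this]
    show ?thesis using k True by (simp add: a'_eq b'_eq)
  next
    case False
    with k have [simp]: "k = n" by simp
    have "0 \<le> omega (1 - \<alpha>) (\<sigma> n - t (n - 1))"
      using sigma_bounds[of n] k \<alpha> by (intro less_imp_le omega_pos) auto
    then have "1 * omega (1 - \<alpha>) (\<sigma> n - t (n - 1)) \<le> (1 - \<alpha> / 2) / (1 - \<alpha>) * omega (1 - \<alpha>) (\<sigma> n - t (n - 1))"
      using \<alpha> by (intro mult_right_mono) (auto simp: field_simps)
    then show ?thesis using a'_last[of n] k by (simp add: b'_def)
  qed
  ultimately show ?thesis using A_eq k by simp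
qed

lemma A_pos: "0 < A n k" if "1 \<le> k" "k \<le> n" "n \<le> N"
proof -
  have "t (k - 1) \<le> t (n - 1)" using that by (intro t_le) auto
  then have "0 < omega (1 - \<alpha>) (\<sigma> n - t (k - 1))"
    using sigma_bounds[of n] that \<alpha> by (intro omega_pos) auto
  also have "\<dots> \<le> A n k" using A_ge that by simp
  finally show ?thesis .
qed

text \<open>
  The convexity of the kernel pushes its mean on cell \<open>k\<close> below the value at \<open>t k\<close> by at least
  \<open>D * h / 2\<close>, where \<open>D\<close> is the slope at \<open>t (k - 1)\<close> and \<open>h\<close> the step size; the correction from the
  cell to the left is at most that, because of the bound on the step ratio.
\<close>

lemma A_le: "A n k \<le> omega (1 - \<alpha>) (\<sigma> n - t k)" if k: "1 \<le> k" "k < n" "n \<le> N"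
proof -
  interpret c: kernel_cell \<alpha> "\<sigma> n" "t (k - 1)" "t k" using cell_ok k by simp
  define D where "D = omega_slope (1 - \<alpha>) (\<sigma> n - t (k - 1))"
  define h where "h = tau t k"
  have D: "0 \<le> D" using \<alpha> by (simp add: D_def omega_slope_nonneg)
  have h: "h > 0" using tau_pos k by (simp add: h_def)
  have "a' n k \<le> 1 / h * (c.W (t k) * h - D * h\<^sup>2 / 2)"
    using c.integral_le h k by (simp add: a'_eq h_def tau_def D_def divide_right_mono)
  also have "\<dots> = c.W (t k) - D * h / 2"
    using h by (simp add: field_simps power2_eq_square)
  finally have a: "a' n k \<le> c.W (t k) - D * h / 2" .
  have b: "rho t (k - 1) * b' n (k - 1) \<le> D * h / 2"
  proof (cases "k = 1")
    case False
    with k have k1: "1 \<le> k - 1" "k - 1 < n" by auto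
    define g \<rho> where "g = tau t (k - 1)" and "\<rho> = rho t (k - 1)"
    have g: "g > 0" using tau_pos k k1 by (simp add: g_def)
    have \<rho>: "0 < \<rho>" "\<rho> \<le> 7 / 4" "g = \<rho> * h"
      using rho_pos[of "k - 1"] rho_le[of "k - 1"] k k1 h by (auto simp: \<rho>_def rho_def g_def h_def)
    have "\<rho> ^ 3 \<le> (7 / 4) ^ 2 * \<rho>"
      using mult_right_mono[OF power_mono[OF \<rho>(2), of 2], of \<rho>] \<rho>(1)
      by (simp add: power2_eq_square power3_eq_cube)
    then have r3: "\<rho> ^ 3 \<le> 3 * (1 + \<rho>)" using \<rho> by (simp add: power2_eq_square)
    have "b' n (k - 1) \<le> 2 / (g * (g + h)) * (D * g ^ 3 / 12)"
    proof -
      have eq: "b' n (k - 1) = 2 / (g * (g + h)) *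
          integral {t (k - 1 - 1)..t (k - 1)} (\<lambda>s. c.W s * (s - (t (k - 1 - 1) + t (k - 1)) / 2))"
        using b'_eq[OF k1 k(3)] False k by (simp add: g_def h_def tau_def)
      show ?thesis unfolding eq
        using kernel_cell.moment_le[OF cell_ok[OF k1 k(3)]] g h
        by (intro mult_left_mono) (auto simp: D_def g_def tau_def)
    qed
    also have "\<dots> = D * g\<^sup>2 / (6 * (g + h))"
      using g h by (simp add: divide_simps power2_eq_square power3_eq_cube)
    finally have "\<rho> * b' n (k - 1) \<le> \<rho> * (D * g\<^sup>2 / (6 * (g + h)))"
      using \<rho> by (intro mult_left_mono) auto
    also have "\<dots> = D * h * (\<rho> ^ 3 / (6 * (1 + \<rho>)))"
    proof -
      have "g + h = (1 + \<rho>) * h" using \<rho> by (simp add: algebra_simps)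
      moreover have "1 + \<rho> \<noteq> 0" using \<rho> by simp
      ultimately show ?thesis
        using \<rho>(3) h by (simp add: divide_simps power2_eq_square power3_eq_cube)
    qed
    also have "\<dots> \<le> D * h * (1 / 2)"
      using r3 \<rho> D h by (intro mult_left_mono) (auto simp: field_simps)
    finally show ?thesis by (simp add: \<rho>_def)
  qed (use D h in \<open>simp add: b'_def\<close>)
  show ?thesis using a b b'_nonneg[of n k] A_eq[of k n] k by simp
qed

lemma A_mono: "A n k \<le> A n (k + 1)" if "1 \<le> k" "k < n" "n \<le> N"
  using A_le[of k n] A_ge[of "k + 1" n] that by simp

text \<open>
  The choice \<open>\<theta> = \<alpha> / 2\<close> enters here: it makes \<open>(1 - \<alpha>) * a' n n\<close> equal to
  \<open>(1 - \<alpha> / 2) * omega (1 - \<alpha>) (\<sigma> n - t (n - 1))\<close>.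
\<close>

lemma A_last_ge: "(1 - \<alpha> / 2) * A n (n - 1) \<le> (1 - \<alpha>) * A n n" if n: "2 \<le> n" "n \<le> N"
proof -
  have "(1 - \<alpha> / 2) * A n (n - 1) \<le> (1 - \<alpha> / 2) * omega (1 - \<alpha>) (\<sigma> n - t (n - 1))"
    using A_le[of "n - 1" n] n \<alpha> by (intro mult_left_mono) auto
  also have "\<dots> = (1 - \<alpha>) * a' n n" using a'_last[of n] n \<alpha> by simp
  also have "\<dots> \<le> (1 - \<alpha>) * A n n"
  proof (rule mult_left_mono)
    have "0 \<le> rho t (n - 1) * b' n (n - 1)"
      using b'_nonneg[of n "n - 1"] rho_pos[of "n - 1"] n
      by (intro mult_nonneg_nonneg less_imp_le[OF rho_pos]) auto
    then show "a' n n \<le> A n n" using A_eq[of n n] n by (simp add: b'_def)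
  qed (use \<alpha> in simp)
  finally show ?thesis .
qed

end

section \<open>The discrete fractional derivative and the complementary kernels\<close>

text \<open>
  Complementary kernels of a triangular array \<open>A\<close> with nonzero diagonal, by forward substitution:
  the defining identity for the pair \<open>(n, n - m)\<close> is solved for the entry with subscript \<open>m\<close>.
\<close>

function compl_kernel :: "(nat \<Rightarrow> nat \<Rightarrow> real) \<Rightarrow> nat \<Rightarrow> nat \<Rightarrow> real" where
  "compl_kernel A n m = (1 - (\<Sum>i\<in>{..<m}. compl_kernel A n i * A (n - i) (m - i))) / A (n - m) 0"
  by pat_completeness auto
termination by (relation "Wellfounded.measure (\<lambda>(A, n, m). m)") auto

declare compl_kernel.simps [simp del]

lemma compl_kernels_exist:
  assumes "\<And>j. 1 \<le> j \<Longrightarrow> j \<le> N \<Longrightarrow> alik_A \<beta> \<theta> t j 0 \<noteq> 0"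
  shows "compl_kernels \<beta> \<theta> N t (compl_kernel (alik_A \<beta> \<theta> t))"
  unfolding compl_kernels_def
proof safe
  fix n k :: nat assume kn: "1 \<le> k" "k \<le> n" "n \<le> N"
  let ?A = "alik_A \<beta> \<theta> t"
  let ?P = "compl_kernel ?A"
  define m where "m = n - k"
  have "(\<Sum>j = k..n. ?P n (n - j) * ?A j (j - k)) = (\<Sum>i\<in>{..m}. ?P n i * ?A (n - i) (m - i))"
    by (rule sum.reindex_bij_witness[of _ "\<lambda>i. n - i" "\<lambda>j. n - j"]) (use kn in \<open>auto simp: m_def\<close>)
  also have "\<dots> = (\<Sum>i\<in>{..<m}. ?P n i * ?A (n - i) (m - i)) + ?P n m * ?A (n - m) 0"
    by (simp add: lessThan_Suc_atMost[symmetric])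
  also have "\<dots> = 1"
  proof -
    have "?A (n - m) 0 \<noteq> 0" using assms[of k] kn by (simp add: m_def)
    then show ?thesis by (simp add: compl_kernel.simps[of ?A n m])
  qed
  finally show "(\<Sum>j = k..n. ?P n (n - j) * ?A j (j - k)) = 1" .
qed

lemma sum_triangle:
  "(\<Sum>n=1..m. \<Sum>k=1..n. f n k) = (\<Sum>k=1..m. \<Sum>n=k..m. f n k)" for m :: nat and f :: "nat \<Rightarrow> nat \<Rightarrow> real"
proof (induction m)
  case (Suc m)
  have "(\<Sum>k=1..Suc m. \<Sum>n=k..Suc m. f n k) = (\<Sum>k=1..Suc m. (\<Sum>n=k..m. f n k) + f (Suc m) k)"
    by (intro sum.cong) auto
  with Suc show ?case by (simp add: sum.distrib)
qed auto

text \<open>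
  By Abel summation the difference of the two sides is a combination of the values \<open>- z k\<close>, \<open>k < n\<close>,
  with nonnegative coefficients.
\<close>

lemma sum_mono_weights_nonpos:
  fixes A z :: "nat \<Rightarrow> real"
  assumes "1 \<le> n" "\<And>k. 1 \<le> k \<Longrightarrow> k < n \<Longrightarrow> A k \<le> A (k + 1)" "0 \<le> A 1" "\<And>k. k \<le> n \<Longrightarrow> z k \<le> 0"
  shows "A n * z n \<le> (\<Sum>k=1..n. A k * (z k - z (k - 1)))"
  using assms
proof (induction n rule: dec_induct)
  case base
  then have "A 1 * z 0 \<le> 0" by (intro mult_nonneg_nonpos) auto
  then show ?case by (simp add: algebra_simps)
next
  case (step n)
  have "A n * z n \<le> (\<Sum>k=1..n. A k * (z k - z (k - 1)))" using step by auto
  moreover have "A (n + 1) * z n \<le> A n * z n"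
    using step by (intro mult_right_mono_neg) auto
  ultimately show ?case using step by (simp add: algebra_simps)
qed

context alikhanov_mesh
begin

abbreviation D :: "(nat \<Rightarrow> real) \<Rightarrow> nat \<Rightarrow> real" where "D \<equiv> frac_diff \<alpha> (\<alpha> / 2) t"

lemma D_nonneg_weights:
  assumes n: "1 \<le> n" "n \<le> N" and z: "\<And>k. k \<le> n \<Longrightarrow> z k \<le> 0" and zn: "z n = 0"
  shows "0 \<le> D z n"
  using sum_mono_weights_nonpos[of n "A n" z] A_mono[of _ n] A_pos[of 1 n] n z zn
  by (simp add: frac_diff_def less_imp_le)

lemma D_linear: "D (\<lambda>k. a * g k + b * h k) n = a * D g n + b * D h n"
  by (simp add: frac_diff_def sum.distrib[symmetric] sum_distrib_left algebra_simps)

lemma D_const: "D (\<lambda>k. a) n = 0"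
  by (simp add: frac_diff_def)

text \<open>
  Energy inequality. With \<open>x\<close> the off-set value, \<open>2 * x * v k - (v k)\<^sup>2 = x\<^sup>2 - (v k - x)\<^sup>2\<close>, so the
  claim is that \<open>D\<close> of \<open>z k = - (v k - x)\<^sup>2\<close> is nonnegative at \<open>n\<close>. Abel summation leaves only the
  two last values of \<open>z\<close>, and the ratio of their coefficients is controlled by \<open>A_last_ge\<close>.
\<close>

lemma D_square_le:
  fixes v :: "nat \<Rightarrow> real"
  assumes n: "1 \<le> n" "n \<le> N"
  shows "D (\<lambda>k. (v k)\<^sup>2) n \<le> 2 * D v n * ((1 - \<alpha> / 2) * v n + \<alpha> / 2 * v (n - 1))"
proof -
  define x where "x = (1 - \<alpha> / 2) * v n + \<alpha> / 2 * v (n - 1)"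
  define z where "z k = - (v k - x)\<^sup>2" for k
  define \<delta> where "\<delta> = v n - v (n - 1)"
  have zn: "z n = - ((\<alpha> / 2)\<^sup>2 * \<delta>\<^sup>2)" "z (n - 1) = - ((1 - \<alpha> / 2)\<^sup>2 * \<delta>\<^sup>2)"
    unfolding z_def x_def \<delta>_def by (simp_all add: power2_eq_square algebra_simps)
  have "0 \<le> D z n"
  proof (cases "n = 1")
    case True
    have "0 \<le> (1 - \<alpha>) * \<delta>\<^sup>2" using \<alpha> by simp
    also have "\<dots> = z 1 - z 0" using zn True by (simp add: power2_eq_square algebra_simps)
    finally show ?thesis using True A_pos[of 1 1] n by (simp add: frac_diff_def)
  next
    case False
    with n have n2: "2 \<le> n" by simp
    have "A n (n - 1) * z (n - 1) \<le> (\<Sum>k=1..n - 1. A n k * (z k - z (k - 1)))"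
      using n2 n A_mono[of _ n] A_pos[of 1 n]
      by (intro sum_mono_weights_nonpos) (auto simp: z_def)
    moreover have "D z n = (\<Sum>k=1..n - 1. A n k * (z k - z (k - 1))) + A n n * (z n - z (n - 1))"
      using n2 unfolding frac_diff_def by (cases n) auto
    ultimately have "A n n * z n - (A n n - A n (n - 1)) * z (n - 1) \<le> D z n"
      by (simp add: algebra_simps)
    moreover have "A n n * z n - (A n n - A n (n - 1)) * z (n - 1)
        = ((1 - \<alpha>) * A n n - (1 - \<alpha> / 2)\<^sup>2 * A n (n - 1)) * \<delta>\<^sup>2"
      unfolding zn by (simp add: power2_eq_square field_simps)
    moreover have "(1 - \<alpha> / 2) * ((1 - \<alpha> / 2) * A n (n - 1)) \<le> (1 - \<alpha> / 2) * A n (n - 1)"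
    proof (rule mult_left_le_one_le)
      have "0 < A n (n - 1)" using n2 n by (intro A_pos) auto
      with \<alpha> show "0 \<le> (1 - \<alpha> / 2) * A n (n - 1)" by simp
    qed (use \<alpha> in auto)
    with A_last_ge[OF n2 n(2)] have "(1 - \<alpha> / 2)\<^sup>2 * A n (n - 1) \<le> (1 - \<alpha>) * A n n"
      by (simp add: power2_eq_square mult.assoc)
    ultimately show ?thesis by (smt (verit) mult_nonneg_nonneg zero_le_power2)
  qed
  also have "z = (\<lambda>k. (-1) * (v k)\<^sup>2 + 1 * (2 * x * v k + (-1) * x\<^sup>2))"
    by (auto simp: z_def power2_eq_square algebra_simps)
  also have "D \<dots> n = 2 * x * D v n - D (\<lambda>k. (v k)\<^sup>2) n"
    by (simp only: D_linear D_const) simp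
  finally show ?thesis by (simp add: x_def algebra_simps)
qed

text \<open>Weights that decrease in time may be moved inside the difference operator.\<close>

lemma D_weights_le:
  assumes n: "1 \<le> n" "n \<le> N" and q: "\<And>k. k \<le> n \<Longrightarrow> q n \<le> q k" and y: "\<And>k. k \<le> n \<Longrightarrow> 0 \<le> y k"
  shows "D (\<lambda>k. q k * y k) n \<le> q n * D y n"
proof -
  have "0 \<le> D (\<lambda>k. q n * y k + (-1) * (q k * y k)) n"
    using q y n by (intro D_nonneg_weights) (auto intro: mult_right_mono)
  then show ?thesis by (simp only: D_linear)
qed

context
  fixes P assumes P: "compl_kernels \<alpha> (\<alpha> / 2) N t P"
begin

lemma compl_sum: "1 \<le> k \<Longrightarrow> k \<le> n \<Longrightarrow> n \<le> N \<Longrightarrow> (\<Sum>j=k..n. P n (n - j) * A j k) = 1"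
  using P by (auto simp: compl_kernels_def)

lemma P_nonneg: "0 \<le> P n (n - k)" if "1 \<le> k" "k \<le> n" "n \<le> N"
  using that
proof (induction "n - k" arbitrary: k rule: less_induct)
  case less
  have split: "(\<Sum>j=k..n. P n (n - j) * A j k) = P n (n - k) * A k k + (\<Sum>j=k+1..n. P n (n - j) * A j k)"
    using less.prems by (simp add: sum.atLeast_Suc_atMost)
  have "(\<Sum>j=k+1..n. P n (n - j) * A j k) \<le> 1"
  proof (cases "k = n")
    case False
    have "(\<Sum>j=k+1..n. P n (n - j) * A j k) \<le> (\<Sum>j=k+1..n. P n (n - j) * A j (k + 1))"
      using less A_mono by (intro sum_mono mult_left_mono) auto
    then show ?thesis using compl_sum[of "k + 1" n] less.prems False by simp
  qed auto
  with split compl_sum[of k n] less.prems have "0 \<le> P n (n - k) * A k k" by simp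
  with A_pos[of k k] less.prems show ?case by (simp add: zero_le_mult_iff)
qed

lemma compl_sum_D: "(\<Sum>n=1..m. P m (m - n) * D v n) = v m - v 0" if m: "1 \<le> m" "m \<le> N"
proof -
  have "(\<Sum>n=1..m. P m (m - n) * D v n) = (\<Sum>n=1..m. \<Sum>k=1..n. P m (m - n) * A n k * (v k - v (k - 1)))"
    by (simp add: frac_diff_def sum_distrib_left mult.assoc)
  also have "\<dots> = (\<Sum>k=1..m. \<Sum>n=k..m. P m (m - n) * A n k * (v k - v (k - 1)))"
    by (rule sum_triangle)
  also have "\<dots> = (\<Sum>k=1..m. v k - v (k - 1))"
    using compl_sum m by (intro sum.cong) (auto simp: sum_distrib_right[symmetric])
  also have "\<dots> = v m - v 0" using sum_telescope''[of 0 m v] by simp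
  finally show ?thesis .
qed

text \<open>The first kernels satisfy \<open>A j 1 \<ge> omega (1 - \<alpha>) (t j)\<close>, and their convolution with \<open>P\<close> is \<open>1\<close>.\<close>

lemma compl_sum_powr: "(\<Sum>j=1..n. P n (n - j) * t j powr - \<alpha>) \<le> Gamma (1 - \<alpha>)" if n: "1 \<le> n" "n \<le> N"
proof -
  have G: "0 < Gamma (1 - \<alpha>)" using \<alpha> by (simp add: Gamma_real_pos)
  have "(\<Sum>j=1..n. P n (n - j) * t j powr - \<alpha>) \<le> (\<Sum>j=1..n. P n (n - j) * (Gamma (1 - \<alpha>) * A j 1))"
  proof (intro sum_mono mult_left_mono)
    fix j assume j: "j \<in> {1..n}"
    have "0 \<le> t (j - 1)" using t_le[of 0 "j - 1"] j n by auto
    then have "0 < \<sigma> j" using sigma_bounds[of j] j n by auto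
    then have "omega (1 - \<alpha>) (t j) \<le> omega (1 - \<alpha>) (\<sigma> j)"
      using sigma_bounds[of j] j n \<alpha> by (intro omega_antimono) auto
    also have "\<dots> \<le> A j 1" using A_ge[of 1 j] j n by simp
    finally have "omega (1 - \<alpha>) (t j) \<le> A j 1" .
    then show "t j powr - \<alpha> \<le> Gamma (1 - \<alpha>) * A j 1"
      using G by (simp add: omega_def field_simps)
  qed (use P_nonneg n in auto)
  also have "\<dots> = Gamma (1 - \<alpha>) * (\<Sum>j=1..n. P n (n - j) * A j 1)"
    by (simp add: sum_distrib_left mult_ac)
  finally show ?thesis using compl_sum[of 1 n] n by simp
qed

text \<open>
  Convolution with \<open>P\<close> damps fast exponentials. The function \<open>y + e\<close>, with \<open>y\<close> the power and \<open>e\<close>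
  the exponential, is a supersolution: the discrete derivative of \<open>y\<close> is large enough up to time
  \<open>1 / \<mu>\<close>, and that of \<open>e\<close> afterwards. Only \<open>A n k \<ge> omega (1 - \<alpha>) (t n - t (k - 1))\<close> is used. The
  bound on the time steps is needed because on one long step the kernel would not see the growth of \<open>e\<close>.
\<close>

lemma compl_sum_exp:
  assumes m: "1 \<le> m" "m \<le> N" and \<mu>: "0 < \<mu>" and step: "\<And>k. 1 \<le> k \<Longrightarrow> k \<le> N \<Longrightarrow> tau t k \<le> 1 / (2 * \<mu>)"
  shows "(\<Sum>n=1..m. P m (m - n) * exp (\<mu> * t n)) \<le> 6 * Gamma (1 - \<alpha>) * \<mu> powr - \<alpha> * exp (\<mu> * t m)"
proof -
  define \<Gamma> where "\<Gamma> = Gamma (1 - \<alpha>)"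
  have G: "0 < \<Gamma>" using \<alpha> by (simp add: \<Gamma>_def Gamma_real_pos)
  define y where "y k = (\<mu> * t k) powr \<alpha>" for k
  define e where "e k = exp (\<mu> * t k)" for k
  have t0: "0 \<le> t k" if "k \<le> N" for k using t_le[of 0 k] that by simp
  have y_mono: "y i \<le> y j" and e_mono: "e i \<le> e j" if "i \<le> j" "j \<le> N" for i j
    using t_le[of i j] t0[of i] that \<mu> \<alpha> by (auto simp: y_def e_def intro!: powr_mono2)
  have D_low: "\<mu> powr \<alpha> * e n \<le> 3 * \<Gamma> * D (\<lambda>k. y k + e k) n" if n: "1 \<le> n" "n \<le> m" for n
  proof -
    have \<omega>: "omega (1 - \<alpha>) r \<le> A n k" if "1 \<le> k" "k \<le> n" "t n - t (k - 1) \<le> r" for k r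
    proof -
      have "t (k - 1) \<le> t (n - 1)" using that n m by (intro t_le) auto
      then have "0 < \<sigma> n - t (k - 1)" "\<sigma> n - t (k - 1) \<le> r"
        using sigma_bounds[of n] n m that by auto
      then have "omega (1 - \<alpha>) r \<le> omega (1 - \<alpha>) (\<sigma> n - t (k - 1))"
        using \<alpha> by (intro omega_antimono) auto
      also have "\<dots> \<le> A n k" using A_ge that n m by auto
      finally show ?thesis .
    qed
    show ?thesis
    proof (cases "t n \<le> 1 / \<mu>")
      case True
      have tn: "0 < t n" using t_less[of 0 n] n m by simp
      have "omega (1 - \<alpha>) (t n) * y n = (\<Sum>k=1..n. omega (1 - \<alpha>) (t n) * (y k - y (k - 1)))"
        using sum_telescope''[of 0 n y] by (simp add: sum_distrib_left[symmetric] y_def)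
      also have "\<dots> \<le> (\<Sum>k=1..n. A n k * ((y k + e k) - (y (k - 1) + e (k - 1))))"
      proof (rule sum_mono)
        fix k assume k: "k \<in> {1..n}"
        have "0 \<le> y k - y (k - 1)" "0 \<le> e k - e (k - 1)"
          using y_mono[of "k - 1" k] e_mono[of "k - 1" k] k n m by auto
        moreover have "omega (1 - \<alpha>) (t n) \<le> A n k"
          using \<omega>[of k "t n"] k t0[of "k - 1"] n m by auto
        ultimately have "omega (1 - \<alpha>) (t n) * (y k - y (k - 1)) \<le> A n k * (y k - y (k - 1))"
          by (intro mult_right_mono) auto
        also have "\<dots> \<le> A n k * ((y k + e k) - (y (k - 1) + e (k - 1)))"
          using \<open>0 \<le> e k - e (k - 1)\<close> A_pos[of k n] k n m by (intro mult_left_mono) auto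
        finally show "omega (1 - \<alpha>) (t n) * (y k - y (k - 1))
            \<le> A n k * ((y k + e k) - (y (k - 1) + e (k - 1)))" .
      qed
      also have "\<dots> = D (\<lambda>k. y k + e k) n" by (simp add: frac_diff_def)
      finally have "\<Gamma> * (omega (1 - \<alpha>) (t n) * y n) \<le> \<Gamma> * D (\<lambda>k. y k + e k) n"
        using G by (intro mult_left_mono) auto
      moreover have "\<Gamma> * (omega (1 - \<alpha>) (t n) * y n) = \<mu> powr \<alpha>"
      proof -
        have "t n powr - \<alpha> * t n powr \<alpha> = 1"
          using tn by (simp add: powr_add[symmetric])
        moreover have "\<Gamma> * (omega (1 - \<alpha>) (t n) * y n) = (t n powr - \<alpha> * t n powr \<alpha>) * \<mu> powr \<alpha>"
          using G \<mu> tn by (simp add: omega_def y_def \<Gamma>_def[symmetric] powr_mult)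
        ultimately show ?thesis by simp
      qed
      moreover have "e n \<le> 3"
      proof -
        have "e n \<le> exp 1" using True \<mu> by (simp add: e_def field_simps)
        then show ?thesis using exp_le by auto
      qed
      then have "\<mu> powr \<alpha> * e n \<le> \<mu> powr \<alpha> * 3" by (intro mult_left_mono) auto
      ultimately show ?thesis by simp
    next
      case False
      \<comment> \<open>the nodes within \<open>1 / \<mu>\<close> of \<open>t n\<close> reach back at least to \<open>t n - 1 / (2 * \<mu>)\<close>\<close>
      define j where "j = (LEAST j. t n - 1 / \<mu> \<le> t j)"
      have j: "t n - 1 / \<mu> \<le> t j" "j \<le> n"
      proof -
        have "t n - 1 / \<mu> \<le> t n" using \<mu> by simp
        then show "t n - 1 / \<mu> \<le> t j" "j \<le> n"
          unfolding j_def by (rule LeastI, rule Least_le)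
      qed
      have "j \<noteq> 0" using j False by (metis diff_le_0_iff_le t_0)
      then have "\<not> t n - 1 / \<mu> \<le> t (j - 1)"
        using not_less_Least[of "j - 1" "\<lambda>j. t n - 1 / \<mu> \<le> t j"] by (simp add: j_def)
      then have tj: "\<mu> * t j \<le> \<mu> * t n - 1 / 2"
        using step[of j] \<open>j \<noteq> 0\<close> j n m \<mu> by (simp add: tau_def field_simps)
      have e_j: "e j \<le> 2 / 3 * e n"
      proof -
        have "e j \<le> exp (\<mu> * t n - 1 / 2)" using tj by (simp add: e_def)
        also have "\<dots> = e n / exp (1 / 2)" by (simp add: e_def exp_diff)
        also have "\<dots> \<le> e n / (3 / 2)"
          using exp_ge_add_one_self[of "1 / 2"] by (intro divide_left_mono) (auto simp: e_def)
        finally show ?thesis by simp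
      qed
      have "omega (1 - \<alpha>) (1 / \<mu>) * (e n - e j) = (\<Sum>k=j+1..n. omega (1 - \<alpha>) (1 / \<mu>) * (e k - e (k - 1)))"
        using sum_telescope''[OF j(2), of e] by (simp add: sum_distrib_left[symmetric])
      also have "\<dots> \<le> (\<Sum>k=j+1..n. A n k * ((y k + e k) - (y (k - 1) + e (k - 1))))"
      proof (rule sum_mono)
        fix k assume k: "k \<in> {j + 1..n}"
        have "0 \<le> y k - y (k - 1)" "0 \<le> e k - e (k - 1)"
          using y_mono[of "k - 1" k] e_mono[of "k - 1" k] k n m by auto
        moreover have "t j \<le> t (k - 1)" using k n m by (intro t_le) auto
        then have "omega (1 - \<alpha>) (1 / \<mu>) \<le> A n k"
          using \<omega>[of k "1 / \<mu>"] k j n m by auto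
        ultimately have "omega (1 - \<alpha>) (1 / \<mu>) * (e k - e (k - 1)) \<le> A n k * (e k - e (k - 1))"
          by (intro mult_right_mono) auto
        also have "\<dots> \<le> A n k * ((y k + e k) - (y (k - 1) + e (k - 1)))"
          using \<open>0 \<le> y k - y (k - 1)\<close> A_pos[of k n] k n m by (intro mult_left_mono) auto
        finally show "omega (1 - \<alpha>) (1 / \<mu>) * (e k - e (k - 1))
            \<le> A n k * ((y k + e k) - (y (k - 1) + e (k - 1)))" .
      qed
      also have "\<dots> \<le> (\<Sum>k=1..n. A n k * ((y k + e k) - (y (k - 1) + e (k - 1))))"
      proof (rule sum_mono2)
        fix k assume "k \<in> {1..n} - {j + 1..n}"
        then have k: "1 \<le> k" "k \<le> n" by auto
        show "0 \<le> A n k * ((y k + e k) - (y (k - 1) + e (k - 1)))"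
          using y_mono[of "k - 1" k] e_mono[of "k - 1" k] k n m A_pos[of k n]
          by (intro mult_nonneg_nonneg) auto
      qed auto
      also have "\<dots> = D (\<lambda>k. y k + e k) n" by (simp add: frac_diff_def)
      finally have "\<Gamma> * (omega (1 - \<alpha>) (1 / \<mu>) * (e n - e j)) \<le> \<Gamma> * D (\<lambda>k. y k + e k) n"
        using G by (intro mult_left_mono) auto
      moreover have "\<Gamma> * (omega (1 - \<alpha>) (1 / \<mu>) * (e n - e j)) = \<mu> powr \<alpha> * (e n - e j)"
        using G \<mu> by (simp add: omega_def \<Gamma>_def[symmetric] powr_minus powr_divide)
      moreover have "\<mu> powr \<alpha> * (e n / 3) \<le> \<mu> powr \<alpha> * (e n - e j)"
        using e_j by (intro mult_left_mono) auto
      ultimately show ?thesis by simp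
    qed
  qed
  have "\<mu> powr \<alpha> * (\<Sum>n=1..m. P m (m - n) * e n) = (\<Sum>n=1..m. P m (m - n) * (\<mu> powr \<alpha> * e n))"
    by (simp add: sum_distrib_left mult_ac)
  also have "\<dots> \<le> (\<Sum>n=1..m. P m (m - n) * (3 * \<Gamma> * D (\<lambda>k. y k + e k) n))"
    using D_low P_nonneg m by (intro sum_mono mult_left_mono) auto
  also have "\<dots> = 3 * \<Gamma> * (\<Sum>n=1..m. P m (m - n) * D (\<lambda>k. y k + e k) n)"
    by (simp add: sum_distrib_left mult_ac)
  also have "\<dots> = 3 * \<Gamma> * (y m + e m - (y 0 + e 0))" using compl_sum_D m by simp
  also have "\<dots> \<le> 3 * \<Gamma> * (2 * e m)"
  proof (intro mult_left_mono)
    define x where "x = \<mu> * t m"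
    have "0 \<le> x" using t0 m \<mu> by (simp add: x_def)
    then have "x powr \<alpha> \<le> (1 + x) powr \<alpha>" using \<alpha> by (intro powr_mono2) auto
    also have "\<dots> \<le> (1 + x) powr 1" using \<alpha> \<open>0 \<le> x\<close> by (intro powr_mono) auto
    also have "\<dots> \<le> exp x" using \<open>0 \<le> x\<close> exp_ge_add_one_self[of x] by simp
    finally have "y m \<le> e m" by (simp add: y_def e_def x_def)
    then show "y m + e m - (y 0 + e 0) \<le> 2 * e m" by (simp add: y_def e_def)
  qed (use G in auto)
  finally have "\<mu> powr \<alpha> * (\<Sum>n=1..m. P m (m - n) * e n) \<le> 6 * \<Gamma> * e m" by simp
  then show ?thesis using \<mu> by (simp add: \<Gamma>_def e_def powr_minus field_simps)
qed

end
end

section \<open>A discrete fractional Gronwall inequality\<close>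

text \<open>The exponent \<open>\<mu>\<close> for which \<open>24 * Gamma (1 - \<alpha>) * L\<close> is less than \<open>\<mu> powr \<alpha>\<close>.\<close>

definition growth_rate :: "real \<Rightarrow> real \<Rightarrow> real" where
  "growth_rate \<alpha> L = (1 + 24 * Gamma (1 - \<alpha>) * L) powr (1 / \<alpha>)"

lemma growth_rate_pos: "0 < \<alpha> \<Longrightarrow> \<alpha> < 1 \<Longrightarrow> 0 \<le> L \<Longrightarrow> 0 < growth_rate \<alpha> L"
  unfolding growth_rate_def
  by (subst powr_gt_zero) (auto simp: Gamma_real_pos add_nonneg_eq_0_iff less_imp_le)

lemma growth_rate_powr: "24 * Gamma (1 - \<alpha>) * L * growth_rate \<alpha> L powr - \<alpha> \<le> 1"
  if "0 < \<alpha>" "\<alpha> < 1" "0 \<le> L"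
proof -
  have G: "0 \<le> 24 * Gamma (1 - \<alpha>) * L" using that by (simp add: Gamma_real_pos less_imp_le)
  then have "growth_rate \<alpha> L powr - \<alpha> = 1 / (1 + 24 * Gamma (1 - \<alpha>) * L)"
    using that by (simp add: growth_rate_def powr_powr powr_minus_divide)
  moreover have "24 * Gamma (1 - \<alpha>) * L / (1 + 24 * Gamma (1 - \<alpha>) * L) \<le> 1"
    by (rule divide_le_eq_1_pos[THEN iffD2]) (use G in linarith, simp)
  ultimately show ?thesis by simp
qed

text \<open>The largest time step allowed by the lemma \<open>compl_sum_exp\<close> for this exponent.\<close>

definition step_bound :: "real \<Rightarrow> real \<Rightarrow> real" where
  "step_bound \<alpha> L = 1 / (2 * growth_rate \<alpha> L)"

context alikhanov_mesh
begin

context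
  fixes P assumes P: "compl_kernels \<alpha> (\<alpha> / 2) N t P"
begin

text \<open>
  With \<open>S\<close> the maximum of \<open>exp (- \<mu> * t k) * V k\<close>, attained at \<open>q\<close>, the choice of \<open>\<mu>\<close> bounds the
  contribution of the terms with \<open>L\<close> by \<open>S / 2\<close>; the rest is a quadratic inequality for \<open>sqrt S\<close>.
\<close>

lemma discrete_gronwall:
  fixes V G :: "nat \<Rightarrow> real"
  assumes M: "1 \<le> M" "M \<le> N" and V: "\<And>k. k \<le> M \<Longrightarrow> 0 \<le> V k" and G: "\<And>k. 0 \<le> G k"
    and L: "0 \<le> L" and \<kappa>: "0 \<le> \<kappa>"
    and step: "\<And>k. 1 \<le> k \<Longrightarrow> k \<le> N \<Longrightarrow> tau t k \<le> step_bound \<alpha> L"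
    and ineq: "\<And>n. 1 \<le> n \<Longrightarrow> n \<le> M \<Longrightarrow>
      D V n \<le> L * (V n + V (n - 1)) + \<kappa> * (sqrt (V n) + sqrt (V (n - 1))) * G n"
    and Q: "\<And>k. 1 \<le> k \<Longrightarrow> k \<le> M \<Longrightarrow> (\<Sum>j=1..k. P k (k - j) * G j) \<le> Q"
    and H: "H = exp (growth_rate \<alpha> L * T / 2)"
  shows "sqrt (V M) \<le> 2 * H * sqrt (V 0) + 4 * \<kappa> * H\<^sup>2 * Q"
proof -
  define \<mu> where "\<mu> = growth_rate \<alpha> L"
  have \<mu>: "0 < \<mu>" using growth_rate_pos \<alpha> L by (simp add: \<mu>_def)
  have step': "tau t k \<le> 1 / (2 * \<mu>)" if "1 \<le> k" "k \<le> N" for k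
    using step[OF that] by (simp add: step_bound_def \<mu>_def)
  note Pn = P_nonneg[OF P]
  have "0 \<le> P 1 (1 - 1) * G 1" using Pn[of 1 1] G M by (intro mult_nonneg_nonneg) auto
  with Q[of 1] M have Q0: "0 \<le> Q" by simp
  have H1: "1 \<le> H" using \<mu> t_less[of 0 N] M by (simp add: H \<mu>_def[symmetric] t_N[symmetric] less_imp_le)
  have tT: "0 \<le> t k" "t k \<le> T" if "k \<le> M" for k
    using t_le[of 0 k] t_le[of k N] that M by (auto simp: t_N)
  define S where "S = Max ((\<lambda>k. exp (- \<mu> * t k) * V k) ` {..M})"
  have "S \<in> (\<lambda>k. exp (- \<mu> * t k) * V k) ` {..M}" unfolding S_def by (rule Max_in) auto
  then obtain q where q: "q \<le> M" "S = exp (- \<mu> * t q) * V q" by auto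
  have V_le: "V k \<le> exp (\<mu> * t k) * S" if "k \<le> M" for k
  proof -
    have "exp (- \<mu> * t k) * V k \<le> S" unfolding S_def using that by (intro Max_ge) auto
    then show ?thesis by (simp add: exp_minus field_simps)
  qed
  define R where "R = sqrt S"
  have S0: "0 \<le> S" using q V by simp
  then have R: "0 \<le> R" "S = R\<^sup>2" by (auto simp: R_def)
  have root_le: "sqrt (V k) \<le> R * H" if "k \<le> M" for k
  proof (rule real_le_lsqrt)
    have "V k \<le> exp (\<mu> * t k) * S" by (rule V_le[OF that])
    also have "\<dots> \<le> exp (\<mu> * T) * S" using tT[OF that] \<mu> S0 by (intro mult_right_mono) auto
    also have "exp (\<mu> * T) = H\<^sup>2" by (simp add: H \<mu>_def exp_double[symmetric])
    finally show "V k \<le> (R * H)\<^sup>2" using R by (simp add: power_mult_distrib mult.commute)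
  qed (use V[OF that] R H1 in auto)
  have le: "S \<le> V 0 + S / 2 + 2 * \<kappa> * R * H * Q"
  proof (cases "q = 0")
    case True
    have "0 \<le> 2 * \<kappa> * R * H * Q" using \<kappa> R H1 Q0 by simp
    moreover have "S = V 0" using True q by simp
    ultimately show ?thesis using S0 by linarith
  next
    case False
    then have q1: "1 \<le> q" "q \<le> N" using q M by auto
    have "V q - V 0 = (\<Sum>n=1..q. P q (q - n) * D V n)"
      using compl_sum_D[OF P q1] by simp
    also have "\<dots> \<le> (\<Sum>n=1..q. P q (q - n) * (2 * L * S * exp (\<mu> * t n) + 2 * \<kappa> * R * H * G n))"
    proof (intro sum_mono mult_left_mono)
      fix n assume n: "n \<in> {1..q}"
      have "V (n - 1) \<le> exp (\<mu> * t (n - 1)) * S" using V_le n q by auto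
      also have "\<dots> \<le> exp (\<mu> * t n) * S"
        using t_le[of "n - 1" n] n q M \<mu> S0 by (intro mult_right_mono) auto
      finally have "V n + V (n - 1) \<le> 2 * S * exp (\<mu> * t n)"
        using V_le[of n] n q by (simp add: mult_ac)
      then have "L * (V n + V (n - 1)) \<le> L * (2 * S * exp (\<mu> * t n))"
        using L by (rule mult_left_mono)
      also have "\<dots> = 2 * L * S * exp (\<mu> * t n)" by simp
      finally have LV: "L * (V n + V (n - 1)) \<le> 2 * L * S * exp (\<mu> * t n)" .
      have "sqrt (V n) + sqrt (V (n - 1)) \<le> R * H + R * H"
        using n q by (intro add_mono root_le) auto
      then have "sqrt (V n) + sqrt (V (n - 1)) \<le> 2 * R * H" by linarith
      then have "\<kappa> * (sqrt (V n) + sqrt (V (n - 1))) * G n \<le> \<kappa> * (2 * R * H) * G n"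
        using \<kappa> G by (intro mult_right_mono mult_left_mono) auto
      also have "\<dots> = 2 * \<kappa> * R * H * G n" by simp
      finally have "\<kappa> * (sqrt (V n) + sqrt (V (n - 1))) * G n \<le> 2 * \<kappa> * R * H * G n" .
      with LV show "D V n \<le> 2 * L * S * exp (\<mu> * t n) + 2 * \<kappa> * R * H * G n"
        using ineq[of n] n q by simp
    qed (use Pn q1 in auto)
    also have "\<dots> = 2 * L * S * (\<Sum>n=1..q. P q (q - n) * exp (\<mu> * t n))
        + 2 * \<kappa> * R * H * (\<Sum>n=1..q. P q (q - n) * G n)"
      by (simp add: sum.distrib sum_distrib_left algebra_simps)
    also have "\<dots> \<le> 2 * L * S * (6 * Gamma (1 - \<alpha>) * \<mu> powr - \<alpha> * exp (\<mu> * t q)) + 2 * \<kappa> * R * H * Q"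
      using compl_sum_exp[OF P q1 \<mu> step'] Q[of q] q1 q L S0 \<kappa> R H1
      by (intro add_mono mult_left_mono) auto
    also have "2 * L * S * (6 * Gamma (1 - \<alpha>) * \<mu> powr - \<alpha> * exp (\<mu> * t q))
        = (24 * Gamma (1 - \<alpha>) * L * \<mu> powr - \<alpha>) * (S / 2 * exp (\<mu> * t q))"
      by simp
    also have "\<dots> \<le> 1 * (S / 2 * exp (\<mu> * t q))"
      using growth_rate_powr[of \<alpha> L] \<alpha> L S0 unfolding \<mu>_def by (intro mult_right_mono) auto
    finally have "V q \<le> V 0 + S / 2 * exp (\<mu> * t q) + 2 * \<kappa> * R * H * Q" by simp
    then have "exp (- \<mu> * t q) * V q
        \<le> exp (- \<mu> * t q) * (V 0 + S / 2 * exp (\<mu> * t q) + 2 * \<kappa> * R * H * Q)"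
      by (intro mult_left_mono) auto
    also have "\<dots> = exp (- \<mu> * t q) * (V 0 + 2 * \<kappa> * R * H * Q) + S / 2"
      by (simp add: exp_minus field_simps)
    also have "\<dots> \<le> 1 * (V 0 + 2 * \<kappa> * R * H * Q) + S / 2"
      using \<mu> tT[of q] q V[of 0] \<kappa> R H1 Q0 by (intro add_mono mult_right_mono) auto
    finally show ?thesis using q by simp
  qed
  define z where "z = 4 * \<kappa> * H * Q"
  have z: "0 \<le> z" using \<kappa> H1 Q0 by (simp add: z_def)
  have "2 * \<kappa> * R * H * Q = z * R / 2" by (simp add: z_def)
  with le have "R\<^sup>2 \<le> 2 * V 0 + z * R" using R(2) by linarith
  moreover have "2 * z * R \<le> z\<^sup>2 + R\<^sup>2" by (rule sum_squares_bound)
  ultimately have "R\<^sup>2 \<le> 4 * V 0 + z\<^sup>2" by linarith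
  also have "4 * V 0 = (2 * sqrt (V 0))\<^sup>2"
    using V[of 0] by (simp add: power_mult_distrib)
  also have "(2 * sqrt (V 0))\<^sup>2 + z\<^sup>2 \<le> (2 * sqrt (V 0) + z)\<^sup>2"
    using V[of 0] z by (simp add: power2_sum)
  finally have "R\<^sup>2 \<le> (2 * sqrt (V 0) + z)\<^sup>2" .
  then have "R \<le> 2 * sqrt (V 0) + z"
    by (rule power2_le_imp_le) (use V[of 0] z in auto)
  then have "R \<le> 2 * sqrt (V 0) + 4 * \<kappa> * H * Q" by (simp add: z_def)
  then have "R * H \<le> (2 * sqrt (V 0) + 4 * \<kappa> * H * Q) * H"
    using H1 by (intro mult_right_mono) auto
  also have "\<dots> = 2 * H * sqrt (V 0) + 4 * \<kappa> * H\<^sup>2 * Q"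
    by (simp add: power2_eq_square distrib_right)
  finally show ?thesis using root_le[of M] by simp
qed

text \<open>
  Stability for a finite family of sequences \<open>g k e\<close>, \<open>e \<in> E\<close>, coupled only through an energy
  inequality with weights that decrease in time. The energy is
  \<open>V k = (\<Sum>e\<in>E. w e (\<sigma> k) * (g k e)\<^sup>2)\<close>: each level carries the weight at its own off-set time.
\<close>

lemma weighted_stability:
  fixes E :: "'e set" and g F :: "nat \<Rightarrow> 'e \<Rightarrow> real" and w :: "'e \<Rightarrow> real \<Rightarrow> real"
  assumes fin: "finite E" and cB: "0 < c" "0 < B" and K: "0 \<le> K"
    and w: "\<And>e s. e \<in> E \<Longrightarrow> 0 \<le> s \<Longrightarrow> s \<le> T \<Longrightarrow> c \<le> w e s \<and> w e s \<le> B"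
    and w_dec: "\<And>e r s. e \<in> E \<Longrightarrow> 0 \<le> r \<Longrightarrow> r \<le> s \<Longrightarrow> s \<le> T \<Longrightarrow> w e s \<le> w e r"
    and energy: "\<And>n. 1 \<le> n \<Longrightarrow> n \<le> N \<Longrightarrow>
      (\<Sum>e\<in>E. w e (\<sigma> n) * D (\<lambda>k. g k e) n * ((1 - \<alpha> / 2) * g n e + \<alpha> / 2 * g (n - 1) e))
      \<le> K * (\<Sum>e\<in>E. ((1 - \<alpha> / 2) * g n e + \<alpha> / 2 * g (n - 1) e)\<^sup>2)
        + (\<Sum>e\<in>E. w e (\<sigma> n) * F n e * ((1 - \<alpha> / 2) * g n e + \<alpha> / 2 * g (n - 1) e))"
    and step: "\<And>k. 1 \<le> k \<Longrightarrow> k \<le> N \<Longrightarrow> tau t k \<le> step_bound \<alpha> (2 * K / c)"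
    and M: "1 \<le> M" "M \<le> N"
    and Q: "\<And>k. 1 \<le> k \<Longrightarrow> k \<le> M \<Longrightarrow> (\<Sum>j=1..k. P k (k - j) * L2_set (F j) E) \<le> Q"
    and H: "H = exp (growth_rate \<alpha> (2 * K / c) * T / 2)"
  shows "L2_set (g M) E \<le> 2 * H * sqrt (B / c) * L2_set (g 0) E + 8 * H\<^sup>2 * (B / c) * Q"
proof -
  define V where "V k = (\<Sum>e\<in>E. w e (\<sigma> k) * (g k e)\<^sup>2)" for k
  define v where "v n e = (1 - \<alpha> / 2) * g n e + \<alpha> / 2 * g (n - 1) e" for n e
  have \<sigma>0: "\<sigma> 0 = 0" by (simp add: t_off_def)
  have \<sigma>: "0 \<le> \<sigma> k" "\<sigma> k \<le> T" if "k \<le> N" for k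
    using sigma_bounds[of k] t_le[of 0 "k - 1"] t_le[of k N] that \<sigma>0 t_le[of 0 N]
    by (cases "k = 0"; force simp: t_N)+
  have \<sigma>_mono: "\<sigma> k \<le> \<sigma> n" if "k \<le> n" "n \<le> N" for k n
  proof (cases "k = n \<or> k = 0")
    case False
    then have "t k \<le> t (n - 1)" using that by (intro t_le) auto
    then show ?thesis using False sigma_bounds[of k] sigma_bounds[of n] that by auto
  qed (use \<sigma> \<sigma>0 that in auto)
  have lower: "c * (L2_set (g k) E)\<^sup>2 \<le> V k" and upper: "V k \<le> B * (L2_set (g k) E)\<^sup>2" if "k \<le> N" for k
    using w \<sigma>[OF that] unfolding V_def L2_set_def
    by (auto simp: sum_nonneg sum_distrib_left intro!: sum_mono mult_right_mono)
  have V0: "0 \<le> V k" if "k \<le> N" for k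
    using lower[OF that] cB by (smt (verit) mult_nonneg_nonneg zero_le_power2)
  have L2_le: "L2_set (g k) E \<le> sqrt (V k) / sqrt c" if "k \<le> N" for k
  proof -
    have "L2_set (g k) E = sqrt (c * (L2_set (g k) E)\<^sup>2) / sqrt c"
      using cB by (simp add: real_sqrt_mult)
    also have "\<dots> \<le> sqrt (V k) / sqrt c" using lower[OF that] cB by (simp add: divide_right_mono)
    finally show ?thesis .
  qed
  have ineq: "D V n \<le> 2 * K / c * (V n + V (n - 1))
      + 2 * B / sqrt c * (sqrt (V n) + sqrt (V (n - 1))) * L2_set (F n) E"
    if n: "1 \<le> n" "n \<le> N" for n
  proof -
    have "D V n = (\<Sum>e\<in>E. D (\<lambda>k. w e (\<sigma> k) * (g k e)\<^sup>2) n)"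
      unfolding frac_diff_def V_def
      by (simp add: sum_distrib_left sum_subtractf[symmetric] sum.swap[of _ E])
    also have "\<dots> \<le> (\<Sum>e\<in>E. 2 * (w e (\<sigma> n) * D (\<lambda>k. g k e) n * v n e))"
    proof (rule sum_mono)
      fix e assume e: "e \<in> E"
      have "D (\<lambda>k. w e (\<sigma> k) * (g k e)\<^sup>2) n \<le> w e (\<sigma> n) * D (\<lambda>k. (g k e)\<^sup>2) n"
        using w_dec[OF e] \<sigma> \<sigma>_mono n by (intro D_weights_le) auto
      also have "\<dots> \<le> w e (\<sigma> n) * (2 * D (\<lambda>k. g k e) n * v n e)"
        using D_square_le[OF n, of "\<lambda>k. g k e"] w[OF e, of "\<sigma> n"] \<sigma>[of n] n cB
        unfolding v_def by (intro mult_left_mono) auto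
      finally show "D (\<lambda>k. w e (\<sigma> k) * (g k e)\<^sup>2) n \<le> 2 * (w e (\<sigma> n) * D (\<lambda>k. g k e) n * v n e)"
        by (simp add: mult_ac)
    qed
    also have "\<dots> = 2 * (\<Sum>e\<in>E. w e (\<sigma> n) * D (\<lambda>k. g k e) n * v n e)"
      by (simp add: sum_distrib_left)
    also have "\<dots> \<le> 2 * (K * (\<Sum>e\<in>E. (v n e)\<^sup>2) + (\<Sum>e\<in>E. w e (\<sigma> n) * F n e * v n e))"
      using energy[OF n] unfolding v_def by (intro mult_left_mono) auto
    finally have DV: "D V n \<le> 2 * K * (\<Sum>e\<in>E. (v n e)\<^sup>2) + 2 * (\<Sum>e\<in>E. w e (\<sigma> n) * F n e * v n e)"
      by simp
    have "(\<Sum>e\<in>E. (v n e)\<^sup>2) \<le> (\<Sum>e\<in>E. (g n e)\<^sup>2 + (g (n - 1) e)\<^sup>2)"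
    proof (rule sum_mono)
      fix e
      have "(v n e)\<^sup>2 + (1 - \<alpha> / 2) * (\<alpha> / 2) * (g n e - g (n - 1) e)\<^sup>2
          = (1 - \<alpha> / 2) * (g n e)\<^sup>2 + \<alpha> / 2 * (g (n - 1) e)\<^sup>2"
        by (simp add: v_def power2_eq_square field_simps)
      moreover have "0 \<le> (1 - \<alpha> / 2) * (\<alpha> / 2) * (g n e - g (n - 1) e)\<^sup>2"
        using \<alpha> by (intro mult_nonneg_nonneg) auto
      moreover have "(1 - \<alpha> / 2) * (g n e)\<^sup>2 \<le> 1 * (g n e)\<^sup>2" "\<alpha> / 2 * (g (n - 1) e)\<^sup>2 \<le> 1 * (g (n - 1) e)\<^sup>2"
        using \<alpha> by (intro mult_right_mono; simp)+
      ultimately show "(v n e)\<^sup>2 \<le> (g n e)\<^sup>2 + (g (n - 1) e)\<^sup>2" by linarith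
    qed
    also have "\<dots> = (L2_set (g n) E)\<^sup>2 + (L2_set (g (n - 1)) E)\<^sup>2"
      by (simp add: L2_set_def sum.distrib sum_nonneg)
    also have "\<dots> \<le> (V n + V (n - 1)) / c"
      using add_mono[OF lower[of n] lower[of "n - 1"]] n cB by (simp add: field_simps)
    finally have v2: "(\<Sum>e\<in>E. (v n e)\<^sup>2) \<le> (V n + V (n - 1)) / c" .
    have "L2_set (v n) E \<le> L2_set (\<lambda>e. (1 - \<alpha> / 2) * g n e) E + L2_set (\<lambda>e. \<alpha> / 2 * g (n - 1) e) E"
      unfolding v_def by (rule L2_set_triangle_ineq)
    also have "\<dots> = (1 - \<alpha> / 2) * L2_set (g n) E + \<alpha> / 2 * L2_set (g (n - 1)) E"
      using \<alpha> L2_set_right_distrib[of "1 - \<alpha> / 2" "g n" E]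
        L2_set_right_distrib[of "\<alpha> / 2" "g (n - 1)" E] by auto
    also have "\<dots> \<le> 1 * L2_set (g n) E + 1 * L2_set (g (n - 1)) E"
      using \<alpha> by (intro add_mono mult_right_mono) auto
    also have "\<dots> \<le> (sqrt (V n) + sqrt (V (n - 1))) / sqrt c"
      using add_mono[OF L2_le[of n] L2_le[of "n - 1"]] n by (simp add: add_divide_distrib)
    finally have v1: "L2_set (v n) E \<le> (sqrt (V n) + sqrt (V (n - 1))) / sqrt c" .
    have "(\<Sum>e\<in>E. w e (\<sigma> n) * F n e * v n e) \<le> (\<Sum>e\<in>E. B * (\<bar>F n e\<bar> * \<bar>v n e\<bar>))"
    proof (rule sum_mono)
      fix e assume e: "e \<in> E"
      have "w e (\<sigma> n) * F n e * v n e \<le> w e (\<sigma> n) * \<bar>F n e * v n e\<bar>"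
        using w[OF e, of "\<sigma> n"] \<sigma>[of n] n cB
        by (simp only: mult.assoc) (intro mult_left_mono, auto)
      also have "\<dots> \<le> B * \<bar>F n e * v n e\<bar>"
        using w[OF e, of "\<sigma> n"] \<sigma>[of n] n by (intro mult_right_mono) auto
      finally show "w e (\<sigma> n) * F n e * v n e \<le> B * (\<bar>F n e\<bar> * \<bar>v n e\<bar>)" by (simp add: abs_mult)
    qed
    also have "\<dots> = B * (\<Sum>e\<in>E. \<bar>F n e\<bar> * \<bar>v n e\<bar>)" by (simp add: sum_distrib_left)
    also have "\<dots> \<le> B * (L2_set (F n) E * L2_set (v n) E)"
      using cB by (intro mult_left_mono L2_set_mult_ineq) auto
    also have "\<dots> \<le> B * (L2_set (F n) E * ((sqrt (V n) + sqrt (V (n - 1))) / sqrt c))"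
      using cB v1 by (intro mult_left_mono) auto
    finally have "2 * (\<Sum>e\<in>E. w e (\<sigma> n) * F n e * v n e)
        \<le> 2 * (B * (L2_set (F n) E * ((sqrt (V n) + sqrt (V (n - 1))) / sqrt c)))"
      by simp
    also have "\<dots> = 2 * B / sqrt c * (sqrt (V n) + sqrt (V (n - 1))) * L2_set (F n) E"
      by simp
    finally have "2 * (\<Sum>e\<in>E. w e (\<sigma> n) * F n e * v n e)
        \<le> 2 * B / sqrt c * (sqrt (V n) + sqrt (V (n - 1))) * L2_set (F n) E" .
    moreover have "2 * K * (\<Sum>e\<in>E. (v n e)\<^sup>2) \<le> 2 * K / c * (V n + V (n - 1))"
      using mult_left_mono[OF v2, of "2 * K"] K by simp
    ultimately show ?thesis using DV by linarith
  qed
  have "sqrt (V M) \<le> 2 * H * sqrt (V 0) + 4 * (2 * B / sqrt c) * H\<^sup>2 * Q"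
    using V0 M K cB step ineq Q H
    by (intro discrete_gronwall[where G = "\<lambda>n. L2_set (F n) E" and L = "2 * K / c"]) auto
  also have "\<dots> \<le> 2 * H * (sqrt B * L2_set (g 0) E) + 4 * (2 * B / sqrt c) * H\<^sup>2 * Q"
  proof -
    have "sqrt (V 0) \<le> sqrt (B * (L2_set (g 0) E)\<^sup>2)" using upper[of 0] by simp
    also have "\<dots> = sqrt B * L2_set (g 0) E" by (simp add: real_sqrt_mult)
    finally show ?thesis by (simp add: H)
  qed
  finally have "sqrt (V M) / sqrt c \<le> (2 * H * (sqrt B * L2_set (g 0) E) + 4 * (2 * B / sqrt c) * H\<^sup>2 * Q) / sqrt c"
    using cB by (intro divide_right_mono) auto
  also have "\<dots> = 2 * H * sqrt (B / c) * L2_set (g 0) E + 8 * H\<^sup>2 * (B / (sqrt c * sqrt c)) * Q"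
    by (simp add: add_divide_distrib real_sqrt_divide) (simp only: mult_ac)
  also have "sqrt c * sqrt c = c" using cB by simp
  finally show ?thesis using L2_le[of M] M by linarith
qed

end
end

section \<open>The discrete energy inequality in space\<close>

lemma summation_by_parts:
  fixes w d :: "nat \<Rightarrow> real"
  assumes "1 \<le> M" "w 0 = 0" "w M = 0"
  shows "(\<Sum>i=1..M - 1. w i * (d i - d (i - 1))) = - (\<Sum>i=0..M - 1. (w (i + 1) - w i) * d i)"
proof -
  have "(\<Sum>i=1..M - 1. w i * (d i - d (i - 1))) + (\<Sum>i=0..M - 1. (w (i + 1) - w i) * d i)
      = w M * d (M - 1) - w 0 * d 0"
    using assms(1)
  proof (induction M rule: dec_induct)
    case (step M)
    then show ?case by (cases M) (auto simp: algebra_simps)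
  qed (auto simp: algebra_simps)
  then show ?thesis using assms by simp
qed

lemma sum_central_diff_le:
  fixes v :: "nat \<Rightarrow> real"
  assumes "1 \<le> M"
  shows "(\<Sum>i=1..M - 1. ((v (i + 1) - v (i - 1)) / (2 * h))\<^sup>2) \<le> (\<Sum>i=0..M - 1. ((v (i + 1) - v i) / h)\<^sup>2)"
proof -
  define d where "d i = ((v (i + 1) - v i) / h)\<^sup>2" for i
  have d: "0 \<le> d i" for i by (simp add: d_def)
  have "(\<Sum>i=1..M - 1. ((v (i + 1) - v (i - 1)) / (2 * h))\<^sup>2) \<le> (\<Sum>i=1..M - 1. d i / 2 + d (i - 1) / 2)"
  proof (rule sum_mono)
    fix i assume "i \<in> {1..M - 1}"
    then have i: "i - 1 + 1 = i" by auto
    let ?a = "(v (i + 1) - v i) / h" and ?b = "(v i - v (i - 1)) / h"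
    have eq: "(v (i + 1) - v (i - 1)) / (2 * h) = (?a + ?b) / 2"
      by (simp add: add_divide_distrib[symmetric])
    have "((?a + ?b) / 2)\<^sup>2 \<le> ?a\<^sup>2 / 2 + ?b\<^sup>2 / 2"
      using sum_squares_bound[of ?a ?b] by (simp only: power_divide power2_sum) simp
    then show "((v (i + 1) - v (i - 1)) / (2 * h))\<^sup>2 \<le> d i / 2 + d (i - 1) / 2"
      unfolding d_def i eq .
  qed
  also have "\<dots> = (\<Sum>i=1..M - 1. d i) / 2 + (\<Sum>i=1..M - 1. d (i - 1)) / 2"
    by (simp add: sum.distrib sum_divide_distrib)
  also have "(\<Sum>i=1..M - 1. d (i - 1)) = (\<Sum>i\<in>{0..<M - 1}. d i)"
    by (rule sum.reindex_bij_witness[of _ Suc "\<lambda>i. i - 1"]) auto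
  also have "\<dots> \<le> (\<Sum>i=0..M - 1. d i)" using d by (intro sum_mono2) auto
  also have "(\<Sum>i=1..M - 1. d i) \<le> (\<Sum>i=0..M - 1. d i)" using d by (intro sum_mono2) auto
  finally show ?thesis unfolding d_def by simp
qed

lemma discrete_poincare:
  fixes v :: "nat \<Rightarrow> real"
  assumes "1 \<le> M" "v 0 = 0" "h \<noteq> 0"
  shows "(\<Sum>i=1..M - 1. (v i)\<^sup>2) \<le> (real M * h)\<^sup>2 * (\<Sum>i=0..M - 1. ((v (i + 1) - v i) / h)\<^sup>2)"
proof -
  define S where "S = (\<Sum>i=0..M - 1. (v (i + 1) - v i)\<^sup>2)"
  have S0: "0 \<le> S" by (simp add: S_def sum_nonneg)
  have pt: "(v i)\<^sup>2 \<le> real M * S" if i: "i \<in> {1..M - 1}" for i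
  proof -
    have "v i = (\<Sum>k<i. v (Suc k) - v k)" using sum_lessThan_telescope[of v i] assms by simp
    then have "(v i)\<^sup>2 \<le> (\<Sum>k<i. 1\<^sup>2) * (\<Sum>k<i. (v (Suc k) - v k)\<^sup>2)"
      using Cauchy_Schwarz_ineq_sum[of "\<lambda>_. 1" "\<lambda>k. v (Suc k) - v k" "{..<i}"] by simp
    also have "\<dots> \<le> (\<Sum>k<i. 1\<^sup>2) * S"
    proof (rule mult_left_mono)
      show "(\<Sum>k<i. (v (Suc k) - v k)\<^sup>2) \<le> S"
        unfolding S_def Suc_eq_plus1 by (rule sum_mono2) (use i in auto)
    qed (simp add: sum_nonneg)
    also have "(\<Sum>k<i. 1\<^sup>2) * S \<le> real M * S"
      using i S0 by (intro mult_right_mono) auto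
    finally show ?thesis .
  qed
  have "(\<Sum>i=1..M - 1. (v i)\<^sup>2) \<le> real (card {1..M - 1}) * (real M * S)"
    by (rule sum_bounded_above) (use pt in auto)
  also have "\<dots> \<le> real M * (real M * S)" using S0 by (intro mult_right_mono) auto
  also have "\<dots> = (real M * h)\<^sup>2 * (\<Sum>i=0..M - 1. ((v (i + 1) - v i) / h)\<^sup>2)"
    using assms by (simp add: S_def power_divide sum_divide_distrib[symmetric] power_mult_distrib power2_eq_square)
  finally show ?thesis .
qed

locale space_mesh =
  fixes xl xr yl yr :: real and Mx My :: nat
  assumes box: "xl < xr" "yl < yr" and M: "1 \<le> Mx" "1 \<le> My"
begin

abbreviation hx where "hx \<equiv> mesh_h xl xr Mx"
abbreviation hy where "hy \<equiv> mesh_h yl yr My"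

lemma h_pos: "0 < hx" "0 < hy"
  using box M by (auto simp: mesh_h_def)

lemma M_h: "real Mx * hx = xr - xl" "real My * hy = yr - yl"
  using M by (auto simp: mesh_h_def)

text \<open>
  The edges that contribute to the gradient norm: \<open>Inl (i, j)\<close> joins the nodes \<open>(i, j)\<close> and
  \<open>(i + 1, j)\<close>, and \<open>Inr (i, j)\<close> joins \<open>(i, j)\<close> and \<open>(i, j + 1)\<close>. Edges within the boundary are left out.
\<close>

definition edges :: "(nat \<times> nat + nat \<times> nat) set" where
  "edges = ({0..Mx - 1} \<times> {1..My - 1}) <+> ({1..Mx - 1} \<times> {0..My - 1})"

lemma finite_edges: "finite edges"
  by (simp add: edges_def)

text \<open>
  The difference quotient along an edge, scaled so that the gradient norm is the Euclidean norm
  of the edge gradients.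
\<close>

fun egrad :: "(nat \<Rightarrow> nat \<Rightarrow> real) \<Rightarrow> nat \<times> nat + nat \<times> nat \<Rightarrow> real" where
  "egrad v (Inl (i, j)) = sqrt (hx * hy) * ((v (i + 1) j - v i j) / hx)"
| "egrad v (Inr (i, j)) = sqrt (hx * hy) * ((v i (j + 1) - v i j) / hy)"

text \<open>The coefficient of the principal part at the midpoint of an edge.\<close>

fun eweight :: "(real \<Rightarrow> real \<Rightarrow> real) \<Rightarrow> (real \<Rightarrow> real \<Rightarrow> real) \<Rightarrow> nat \<times> nat + nat \<times> nat \<Rightarrow> real" where
  "eweight p1 p2 (Inl (i, j)) = p1 (node xl xr Mx (real i + 1 / 2)) (node yl yr My (real j))"
| "eweight p1 p2 (Inr (i, j)) = p2 (node xl xr Mx (real i)) (node yl yr My (real j + 1 / 2))"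

lemma sum_edges:
  "(\<Sum>e\<in>edges. f e) = (\<Sum>i=0..Mx - 1. \<Sum>j=1..My - 1. f (Inl (i, j)))
     + (\<Sum>i=1..Mx - 1. \<Sum>j=0..My - 1. f (Inr (i, j)))"
  by (simp add: edges_def sum.Plus sum.cartesian_product)

lemma grad_norm_L2: "grad_norm xl xr yl yr Mx My v = L2_set (egrad v) edges"
  using h_pos by (simp add: grad_norm_def L2_set_def sum_edges Let_def power_mult_distrib power_divide sum_distrib_left)

lemma egrad_linear: "egrad (\<lambda>i j. a * v i j + b * w i j) e = a * egrad v e + b * egrad w e"
  by (cases e; cases "projl e"; cases "projr e")
     (auto simp: algebra_simps add_divide_distrib diff_divide_distrib)

lemma egrad_sum: "egrad (\<lambda>i j. \<Sum>k\<in>K. c k * v k i j) e = (\<Sum>k\<in>K. c k * egrad (v k) e)"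
  by (cases e; cases "projl e"; cases "projr e")
     (auto simp: sum_distrib_left sum_subtractf[symmetric] sum_divide_distrib algebra_simps)

text \<open>Grid functions that vanish at the boundary nodes.\<close>

definition zero_bd :: "(nat \<Rightarrow> nat \<Rightarrow> real) \<Rightarrow> bool" where
  "zero_bd v \<longleftrightarrow> (\<forall>i j. i \<le> Mx \<and> j \<le> My \<and> (i = 0 \<or> i = Mx \<or> j = 0 \<or> j = My) \<longrightarrow> v i j = 0)"

text \<open>The principal part of the elliptic operator, without the factor \<open>1 / p\<close>.\<close>

definition L_h :: "(real \<Rightarrow> real \<Rightarrow> real) \<Rightarrow> (real \<Rightarrow> real \<Rightarrow> real) \<Rightarrow> (nat \<Rightarrow> nat \<Rightarrow> real) \<Rightarrow> nat \<Rightarrow> nat \<Rightarrow> real" where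
  "L_h p1 p2 v i j = A_h xl xr yl yr Mx My (\<lambda>x y. 1) p1 p2 (\<lambda>x y. 0) (\<lambda>x y. 0) (\<lambda>x y. 0) v i j"

abbreviation inner_sum :: "(nat \<Rightarrow> nat \<Rightarrow> real) \<Rightarrow> real" where
  "inner_sum f \<equiv> \<Sum>i=1..Mx - 1. \<Sum>j=1..My - 1. f i j"

text \<open>Discrete Green identity; only the test function \<open>w\<close> has to vanish on the boundary.\<close>

lemma green:
  assumes w: "zero_bd w"
  shows "hx * hy * inner_sum (\<lambda>i j. w i j * L_h p1 p2 v i j)
    = - (\<Sum>e\<in>edges. eweight p1 p2 e * egrad w e * egrad v e)"
proof -
  define dx where "dx i j = eweight p1 p2 (Inl (i, j)) * ((v (i + 1) j - v i j) / hx)" for i j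
  define dy where "dy i j = eweight p1 p2 (Inr (i, j)) * ((v i (j + 1) - v i j) / hy)" for i j
  have L: "L_h p1 p2 v i j = (dx i j - dx (i - 1) j) / hx + (dy i j - dy i (j - 1)) / hy"
    if "1 \<le> i" "1 \<le> j" for i j
    using that by (simp add: L_h_def A_h_def Let_def dx_def dy_def of_nat_diff)
  have X: "(\<Sum>i=1..Mx - 1. w i j * (dx i j - dx (i - 1) j)) = - (\<Sum>i=0..Mx - 1. (w (i + 1) j - w i j) * dx i j)"
    if "j \<in> {1..My - 1}" for j
    using w M that by (intro summation_by_parts) (auto simp: zero_bd_def)
  have Y: "(\<Sum>j=1..My - 1. w i j * (dy i j - dy i (j - 1))) = - (\<Sum>j=0..My - 1. (w i (j + 1) - w i j) * dy i j)"
    if "i \<in> {1..Mx - 1}" for i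
    using w M that by (intro summation_by_parts) (auto simp: zero_bd_def)
  have "inner_sum (\<lambda>i j. w i j * L_h p1 p2 v i j)
      = inner_sum (\<lambda>i j. w i j * (dx i j - dx (i - 1) j) / hx + w i j * (dy i j - dy i (j - 1)) / hy)"
    by (intro sum.cong refl) (simp add: L algebra_simps)
  also have "\<dots> = inner_sum (\<lambda>i j. w i j * (dx i j - dx (i - 1) j)) / hx
      + (\<Sum>i=1..Mx - 1. \<Sum>j=1..My - 1. w i j * (dy i j - dy i (j - 1))) / hy"
    by (simp add: sum.distrib sum_divide_distrib)
  also have "inner_sum (\<lambda>i j. w i j * (dx i j - dx (i - 1) j))
      = (\<Sum>j=1..My - 1. \<Sum>i=1..Mx - 1. w i j * (dx i j - dx (i - 1) j))" by (rule sum.swap)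
  also have "(\<Sum>j=1..My - 1. \<Sum>i=1..Mx - 1. w i j * (dx i j - dx (i - 1) j)) / hx
      + (\<Sum>i=1..Mx - 1. \<Sum>j=1..My - 1. w i j * (dy i j - dy i (j - 1))) / hy
      = - ((\<Sum>j=1..My - 1. \<Sum>i=0..Mx - 1. (w (i + 1) j - w i j) * dx i j) / hx
      + (\<Sum>i=1..Mx - 1. \<Sum>j=0..My - 1. (w i (j + 1) - w i j) * dy i j) / hy)"
    using X Y by (simp add: sum_negf)
  also have "(\<Sum>j=1..My - 1. \<Sum>i=0..Mx - 1. (w (i + 1) j - w i j) * dx i j)
      = (\<Sum>i=0..Mx - 1. \<Sum>j=1..My - 1. (w (i + 1) j - w i j) * dx i j)" by (rule sum.swap)
  finally have "hx * hy * inner_sum (\<lambda>i j. w i j * L_h p1 p2 v i j)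
      = - (hx * hy * ((\<Sum>i=0..Mx - 1. \<Sum>j=1..My - 1. (w (i + 1) j - w i j) * dx i j) / hx
      + (\<Sum>i=1..Mx - 1. \<Sum>j=0..My - 1. (w i (j + 1) - w i j) * dy i j) / hy))"
    by (simp only: mult_minus_right)
  also have "\<dots> = - ((\<Sum>i=0..Mx - 1. \<Sum>j=1..My - 1. hx * hy * ((w (i + 1) j - w i j) / hx * dx i j))
      + (\<Sum>i=1..Mx - 1. \<Sum>j=0..My - 1. hx * hy * ((w i (j + 1) - w i j) / hy * dy i j)))"
    by (simp add: sum_divide_distrib sum_distrib_left distrib_left)
  also have "\<dots> = - (\<Sum>e\<in>edges. eweight p1 p2 e * egrad w e * egrad v e)"
  proof -
    have "sqrt (hx * hy) * sqrt (hx * hy) = hx * hy"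
      using h_pos by (intro real_sqrt_mult_self[THEN trans]) simp
    then have s: "q * (sqrt (hx * hy) * a) * (sqrt (hx * hy) * b) = hx * hy * (a * (q * b))" for q a b
      by (metis mult.assoc mult.left_commute)
    have "eweight p1 p2 (Inl (i, j)) * egrad w (Inl (i, j)) * egrad v (Inl (i, j))
        = hx * hy * ((w (i + 1) j - w i j) / hx * dx i j)" for i j
      unfolding egrad.simps dx_def by (rule s)
    moreover have "eweight p1 p2 (Inr (i, j)) * egrad w (Inr (i, j)) * egrad v (Inr (i, j))
        = hx * hy * ((w i (j + 1) - w i j) / hy * dy i j)" for i j
      unfolding egrad.simps dy_def by (rule s)
    ultimately show ?thesis by (simp only: sum_edges)
  qed
  finally show ?thesis .
qed

lemma edge_sq_sum: "(\<Sum>e\<in>edges. (egrad v e)\<^sup>2)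
    = hx * hy * ((\<Sum>i=0..Mx - 1. \<Sum>j=1..My - 1. ((v (i + 1) j - v i j) / hx)\<^sup>2)
     + (\<Sum>i=1..Mx - 1. \<Sum>j=0..My - 1. ((v i (j + 1) - v i j) / hy)\<^sup>2))"
  using h_pos by (simp add: sum_edges power_mult_distrib power_divide sum_distrib_left distrib_left)

text \<open>The Poincare inequality is applied in the \<open>x\<close> direction only, whence the constant \<open>(xr - xl)\<^sup>2\<close>.\<close>

lemma lower_order_le:
  assumes v: "zero_bd v" and b: "0 \<le> b"
    and R: "\<And>i j. 1 \<le> i \<Longrightarrow> i < Mx \<Longrightarrow> 1 \<le> j \<Longrightarrow> j < My \<Longrightarrow>
      \<bar>R i j\<bar> \<le> b * (\<bar>(v (i + 1) j - v (i - 1) j) / (2 * hx)\<bar> + \<bar>(v i (j + 1) - v i (j - 1)) / (2 * hy)\<bar> + \<bar>v i j\<bar>)"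
  shows "hx * hy * inner_sum (\<lambda>i j. (R i j)\<^sup>2) \<le> 3 * b\<^sup>2 * (1 + (xr - xl)\<^sup>2) * (\<Sum>e\<in>edges. (egrad v e)\<^sup>2)"
proof -
  let ?X = "\<Sum>i=0..Mx - 1. \<Sum>j=1..My - 1. ((v (i + 1) j - v i j) / hx)\<^sup>2"
  let ?Y = "\<Sum>i=1..Mx - 1. \<Sum>j=0..My - 1. ((v i (j + 1) - v i j) / hy)\<^sup>2"
  let ?a = "\<lambda>i j. (v (i + 1) j - v (i - 1) j) / (2 * hx)"
  let ?b = "\<lambda>i j. (v i (j + 1) - v i (j - 1)) / (2 * hy)"
  have sq: "r\<^sup>2 \<le> 3 * b\<^sup>2 * (x\<^sup>2 + y\<^sup>2 + z\<^sup>2)" if "\<bar>r\<bar> \<le> b * (\<bar>x\<bar> + \<bar>y\<bar> + \<bar>z\<bar>)" for r x y z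
  proof -
    have "r\<^sup>2 \<le> (b * (\<bar>x\<bar> + \<bar>y\<bar> + \<bar>z\<bar>))\<^sup>2" using that by (metis abs_ge_zero power2_abs power_mono)
    also have "\<dots> = b\<^sup>2 * (\<bar>x\<bar> + \<bar>y\<bar> + \<bar>z\<bar>)\<^sup>2" by (simp add: power_mult_distrib)
    also have "\<dots> \<le> b\<^sup>2 * (3 * (x\<^sup>2 + y\<^sup>2 + z\<^sup>2))"
    proof (rule mult_left_mono)
      have "0 \<le> (\<bar>x\<bar> - \<bar>y\<bar>)\<^sup>2 + (\<bar>y\<bar> - \<bar>z\<bar>)\<^sup>2 + (\<bar>x\<bar> - \<bar>z\<bar>)\<^sup>2" by simp
      then show "(\<bar>x\<bar> + \<bar>y\<bar> + \<bar>z\<bar>)\<^sup>2 \<le> 3 * (x\<^sup>2 + y\<^sup>2 + z\<^sup>2)"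
        by (simp add: power2_eq_square algebra_simps)
    qed simp
    finally show ?thesis by (simp add: algebra_simps)
  qed
  have "inner_sum (\<lambda>i j. (R i j)\<^sup>2) \<le> inner_sum (\<lambda>i j. 3 * b\<^sup>2 * ((?a i j)\<^sup>2 + (?b i j)\<^sup>2 + (v i j)\<^sup>2))"
    using R by (intro sum_mono sq) auto
  also have "\<dots> = 3 * b\<^sup>2 * (inner_sum (\<lambda>i j. (?a i j)\<^sup>2) + inner_sum (\<lambda>i j. (?b i j)\<^sup>2) + inner_sum (\<lambda>i j. (v i j)\<^sup>2))"
    by (simp only: sum_distrib_left[symmetric] sum.distrib)
  also have "\<dots> \<le> 3 * b\<^sup>2 * (?X + ?Y + (xr - xl)\<^sup>2 * ?X)"
  proof (intro mult_left_mono add_mono)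
    have X: "(\<Sum>j=1..My - 1. \<Sum>i=0..Mx - 1. ((v (i + 1) j - v i j) / hx)\<^sup>2) = ?X" by (rule sum.swap)
    have "inner_sum (\<lambda>i j. (?a i j)\<^sup>2) = (\<Sum>j=1..My - 1. \<Sum>i=1..Mx - 1. (?a i j)\<^sup>2)" by (rule sum.swap)
    also have "\<dots> \<le> (\<Sum>j=1..My - 1. \<Sum>i=0..Mx - 1. ((v (i + 1) j - v i j) / hx)\<^sup>2)"
      by (rule sum_mono, rule sum_central_diff_le, rule M)
    finally show "inner_sum (\<lambda>i j. (?a i j)\<^sup>2) \<le> ?X" unfolding X .
    show "inner_sum (\<lambda>i j. (?b i j)\<^sup>2) \<le> ?Y"
      by (rule sum_mono, rule sum_central_diff_le, rule M)
    have "inner_sum (\<lambda>i j. (v i j)\<^sup>2) = (\<Sum>j=1..My - 1. \<Sum>i=1..Mx - 1. (v i j)\<^sup>2)" by (rule sum.swap)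
    also have "\<dots> \<le> (\<Sum>j=1..My - 1. (real Mx * hx)\<^sup>2 * (\<Sum>i=0..Mx - 1. ((v (i + 1) j - v i j) / hx)\<^sup>2))"
      using v M h_pos by (intro sum_mono discrete_poincare) (auto simp: zero_bd_def)
    also have "\<dots> = (xr - xl)\<^sup>2 * ?X"
      unfolding X[symmetric] M_h sum_distrib_left ..
    finally show "inner_sum (\<lambda>i j. (v i j)\<^sup>2) \<le> (xr - xl)\<^sup>2 * ?X" .
  qed auto
  also have "\<dots> \<le> 3 * b\<^sup>2 * ((1 + (xr - xl)\<^sup>2) * (?X + ?Y))"
  proof (intro mult_left_mono)
    have "0 \<le> (xr - xl)\<^sup>2 * ?Y" by (intro mult_nonneg_nonneg sum_nonneg) auto
    then show "?X + ?Y + (xr - xl)\<^sup>2 * ?X \<le> (1 + (xr - xl)\<^sup>2) * (?X + ?Y)"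
      by (simp only: distrib_left distrib_right mult_1)
  qed auto
  finally have "hx * hy * inner_sum (\<lambda>i j. (R i j)\<^sup>2) \<le> hx * hy * (3 * b\<^sup>2 * ((1 + (xr - xl)\<^sup>2) * (?X + ?Y)))"
    using h_pos by (intro mult_left_mono) auto
  also have "\<dots> = 3 * b\<^sup>2 * (1 + (xr - xl)\<^sup>2) * (hx * hy * (?X + ?Y))"
    by (simp only: mult.commute mult.left_commute mult.assoc)
  finally show ?thesis by (simp only: edge_sq_sum)
qed

text \<open>
  The equation is tested with \<open>- L_h p1 p2 v\<close>. Completing the square,
  \<open>- (1 / p) * L\<^sup>2 - R * L \<le> p / 4 * R\<^sup>2\<close>, removes the second differences; \<open>R\<close> collects the lower-order terms.
\<close>

lemma energy_inequality:
  assumes d: "zero_bd d" and F: "zero_bd F" and v: "zero_bd v" and b: "0 \<le> b" and B: "0 \<le> B"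
    and p: "\<And>i j. 1 \<le> i \<Longrightarrow> i < Mx \<Longrightarrow> 1 \<le> j \<Longrightarrow> j < My \<Longrightarrow>
      0 < p (node xl xr Mx (real i)) (node yl yr My (real j)) \<and> p (node xl xr Mx (real i)) (node yl yr My (real j)) \<le> B"
    and low: "\<And>i j. 1 \<le> i \<Longrightarrow> i < Mx \<Longrightarrow> 1 \<le> j \<Longrightarrow> j < My \<Longrightarrow>
      \<bar>p3 (node xl xr Mx (real i)) (node yl yr My (real j))\<bar> \<le> b \<and>
      \<bar>p4 (node xl xr Mx (real i)) (node yl yr My (real j))\<bar> \<le> b \<and>
      \<bar>b3 (node xl xr Mx (real i)) (node yl yr My (real j))\<bar> \<le> b"
    and eq: "\<And>i j. 1 \<le> i \<Longrightarrow> i < Mx \<Longrightarrow> 1 \<le> j \<Longrightarrow> j < My \<Longrightarrow>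
      d i j = A_h xl xr yl yr Mx My p p1 p2 p3 p4 b3 v i j + F i j"
  shows "(\<Sum>e\<in>edges. eweight p1 p2 e * egrad d e * egrad v e)
    \<le> B * b\<^sup>2 * (1 + (xr - xl)\<^sup>2) * (\<Sum>e\<in>edges. (egrad v e)\<^sup>2)
      + (\<Sum>e\<in>edges. eweight p1 p2 e * egrad F e * egrad v e)"
proof -
  let ?x = "\<lambda>i. node xl xr Mx (real i)" and ?y = "\<lambda>j. node yl yr My (real j)"
  let ?L = "L_h p1 p2 v"
  define R where "R i j = p3 (?x i) (?y j) * ((v (i + 1) j - v (i - 1) j) / (2 * hx))
    + p4 (?x i) (?y j) * ((v i (j + 1) - v i (j - 1)) / (2 * hy)) + b3 (?x i) (?y j) * v i j" for i j
  have R: "hx * hy * inner_sum (\<lambda>i j. (R i j)\<^sup>2) \<le> 3 * b\<^sup>2 * (1 + (xr - xl)\<^sup>2) * (\<Sum>e\<in>edges. (egrad v e)\<^sup>2)"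
  proof (rule lower_order_le[OF v b])
    fix i j assume ij: "1 \<le> i" "i < Mx" "1 \<le> j" "j < My"
    let ?a = "(v (i + 1) j - v (i - 1) j) / (2 * hx)" and ?b = "(v i (j + 1) - v i (j - 1)) / (2 * hy)"
    have "\<bar>R i j\<bar> \<le> \<bar>p3 (?x i) (?y j)\<bar> * \<bar>?a\<bar> + \<bar>p4 (?x i) (?y j)\<bar> * \<bar>?b\<bar> + \<bar>b3 (?x i) (?y j)\<bar> * \<bar>v i j\<bar>"
      unfolding R_def abs_mult[symmetric] by linarith
    also have "\<dots> \<le> b * \<bar>?a\<bar> + b * \<bar>?b\<bar> + b * \<bar>v i j\<bar>"
      using low[OF ij] by (intro add_mono mult_right_mono) auto
    finally show "\<bar>R i j\<bar> \<le> b * (\<bar>?a\<bar> + \<bar>?b\<bar> + \<bar>v i j\<bar>)" by (simp add: distrib_left)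
  qed
  have "inner_sum (\<lambda>i j. F i j * ?L i j - d i j * ?L i j) \<le> inner_sum (\<lambda>i j. B / 4 * (R i j)\<^sup>2)"
  proof (intro sum_mono)
    fix i j assume "i \<in> {1..Mx - 1}" "j \<in> {1..My - 1}"
    then have ij: "1 \<le> i" "i < Mx" "1 \<le> j" "j < My" using M by auto
    define P where "P = p (?x i) (?y j)"
    have P: "0 < P" "P \<le> B" using p[OF ij] by (auto simp: P_def)
    have "d i j = inverse P * ?L i j + R i j + F i j"
      unfolding eq[OF ij] R_def P_def by (simp add: A_h_def L_h_def Let_def)
    then have "F i j * ?L i j - d i j * ?L i j = - (inverse P * ?L i j * ?L i j) - R i j * ?L i j"
      by (simp add: algebra_simps)
    also have "\<dots> = P / 4 * (R i j)\<^sup>2 - inverse P * (?L i j + P / 2 * R i j)\<^sup>2"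
      using P by (simp add: power2_eq_square field_simps)
    also have "\<dots> \<le> P / 4 * (R i j)\<^sup>2" using P by simp
    also have "\<dots> \<le> B / 4 * (R i j)\<^sup>2" using P by (intro mult_right_mono) auto
    finally show "F i j * ?L i j - d i j * ?L i j \<le> B / 4 * (R i j)\<^sup>2" .
  qed
  then have "hx * hy * (inner_sum (\<lambda>i j. F i j * ?L i j) - inner_sum (\<lambda>i j. d i j * ?L i j))
      \<le> hx * hy * (B / 4 * inner_sum (\<lambda>i j. (R i j)\<^sup>2))"
    using h_pos by (intro mult_left_mono) (simp_all only: sum_subtractf sum_distrib_left mult_pos_pos less_imp_le)
  then have "(\<Sum>e\<in>edges. eweight p1 p2 e * egrad d e * egrad v e)
      - (\<Sum>e\<in>edges. eweight p1 p2 e * egrad F e * egrad v e)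
      \<le> B / 4 * (hx * hy * inner_sum (\<lambda>i j. (R i j)\<^sup>2))"
    using green[OF d, of p1 p2 v] green[OF F, of p1 p2 v] 
    by (simp only: right_diff_distrib) (simp add: mult_ac)
  also have "\<dots> \<le> B / 4 * (3 * b\<^sup>2 * (1 + (xr - xl)\<^sup>2) * (\<Sum>e\<in>edges. (egrad v e)\<^sup>2))"
    using R B by (intro mult_left_mono) auto
  also have "\<dots> = 3 / 4 * (B * b\<^sup>2 * (1 + (xr - xl)\<^sup>2) * (\<Sum>e\<in>edges. (egrad v e)\<^sup>2))" by simp
  also have "\<dots> \<le> 1 * (B * b\<^sup>2 * (1 + (xr - xl)\<^sup>2) * (\<Sum>e\<in>edges. (egrad v e)\<^sup>2))"
    using B by (intro mult_right_mono mult_nonneg_nonneg sum_nonneg) auto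
  finally show ?thesis by simp
qed

end

section \<open>Stability of the scheme\<close>

lemma node_in: "node l r M a \<in> {l<..<r}" if "l < r" "0 < a" "a < real M"
proof -
  have "a * (r - l) < real M * (r - l)" using that by simp
  then show ?thesis using that by (simp add: node_def mesh_h_def field_simps)
qed

lemma A_h_diff:
  "A_h xl xr yl yr Mx My p p1 p2 p3 p4 b3 (\<lambda>i j. v i j - w i j) i j
    = A_h xl xr yl yr Mx My p p1 p2 p3 p4 b3 v i j - A_h xl xr yl yr Mx My p p1 p2 p3 p4 b3 w i j"
  unfolding A_h_def Let_def divide_inverse by (simp only: algebra_simps)

lemma scheme_solution_diff:
  assumes "scheme_solution \<beta> \<theta> xl xr yl yr p p1 p2 p3 p4 b3 Mx My N t \<phi> f u"
    and "scheme_solution \<beta> \<theta> xl xr yl yr p p1 p2 p3 p4 b3 Mx My N t \<psi> g v"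
  shows "scheme_solution \<beta> \<theta> xl xr yl yr p p1 p2 p3 p4 b3 Mx My N t
    (\<lambda>x y. \<phi> x y - \<psi> x y) (\<lambda>x y s. f x y s - g x y s) (\<lambda>n i j. u n i j - v n i j)"
proof -
  have D: "frac_diff \<beta> \<theta> t (\<lambda>k. u k i j - v k i j) n
      = frac_diff \<beta> \<theta> t (\<lambda>k. u k i j) n - frac_diff \<beta> \<theta> t (\<lambda>k. v k i j) n" for n i j
    unfolding frac_diff_def sum_subtractf[symmetric] by (intro sum.cong refl) (simp only: algebra_simps)
  have c: "(\<lambda>i j. (1 - \<theta>) * (u n i j - v n i j) + \<theta> * (u (n - 1) i j - v (n - 1) i j))
      = (\<lambda>i j. ((1 - \<theta>) * u n i j + \<theta> * u (n - 1) i j) - ((1 - \<theta>) * v n i j + \<theta> * v (n - 1) i j))" for n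
    by (intro ext) (simp add: algebra_simps)
  note u = assms(1)[unfolded scheme_solution_def Let_def]
  note v = assms(2)[unfolded scheme_solution_def Let_def]
  show ?thesis
  proof (unfold scheme_solution_def Let_def, intro conjI allI impI, goal_cases)
    case (1 n i j)
    show ?case
      unfolding D c A_h_diff u[THEN conjunct1, rule_format, OF 1] v[THEN conjunct1, rule_format, OF 1]
      by (simp only: algebra_simps)
  next
    case (2 i j)
    then show ?case using u v by simp
  next
    case (3 n i j)
    then show ?case using u[THEN conjunct2, THEN conjunct2] v[THEN conjunct2, THEN conjunct2] by simp
  qed
qed

text \<open>
  The properties of the coefficients on which stability rests: positivity and boundedness of \<open>p\<close>,
  \<open>p1\<close>, \<open>p2\<close>, boundedness of the lower-order coefficients, and decrease in time of \<open>p1\<close> and \<open>p2\<close>.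
\<close>

locale parabolic_coefficients =
  fixes \<alpha> T xl xr yl yr c B b :: real and p p1 p2 p3 p4 b3 :: "real \<Rightarrow> real \<Rightarrow> real \<Rightarrow> real"
  assumes \<alpha>: "0 < \<alpha>" "\<alpha> < 1" and box: "xl < xr" "yl < yr" and pos: "0 < c" "0 < B" "0 \<le> b"
    and p_bounds: "\<And>x y s. \<lbrakk>x \<in> {xl<..<xr}; y \<in> {yl<..<yr}; s \<in> {0..T}\<rbrakk> \<Longrightarrow> 0 < p x y s \<and> p x y s \<le> B"
    and p12_bounds: "\<And>x y s. \<lbrakk>x \<in> {xl<..<xr}; y \<in> {yl<..<yr}; s \<in> {0..T}\<rbrakk> \<Longrightarrow>
      c \<le> p1 x y s \<and> p1 x y s \<le> B \<and> c \<le> p2 x y s \<and> p2 x y s \<le> B"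
    and low_bounds: "\<And>x y s. \<lbrakk>x \<in> {xl<..<xr}; y \<in> {yl<..<yr}; s \<in> {0..T}\<rbrakk> \<Longrightarrow>
      \<bar>p3 x y s\<bar> \<le> b \<and> \<bar>p4 x y s\<bar> \<le> b \<and> \<bar>b3 x y s\<bar> \<le> b"
    and p12_dec: "\<And>x y r s. \<lbrakk>x \<in> {xl<..<xr}; y \<in> {yl<..<yr}; 0 \<le> r; r \<le> s; s \<le> T\<rbrakk> \<Longrightarrow>
      p1 x y s \<le> p1 x y r \<and> p2 x y s \<le> p2 x y r"
begin

text \<open>
  \<open>K\<close> is the constant of the energy inequality, \<open>\<tau>0\<close> the bound on the time steps, \<open>H\<close> the
  square root of the exponential growth factor up to time \<open>T\<close>, and \<open>C\<close> the stability constant. None depends on the meshes.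
\<close>

definition K where "K = B * b\<^sup>2 * (1 + (xr - xl)\<^sup>2)"
definition \<tau>0 where "\<tau>0 = step_bound \<alpha> (2 * K / c)"
definition H where "H = exp (growth_rate \<alpha> (2 * K / c) * T / 2)"
definition C where "C = 2 * H * sqrt (B / c) + 8 * H\<^sup>2 * (B / c)"

lemma K_nonneg: "0 \<le> K"
  using pos by (simp add: K_def)

lemma \<tau>0_pos: "0 < \<tau>0"
  using growth_rate_pos[of \<alpha> "2 * K / c"] \<alpha> K_nonneg pos by (simp add: \<tau>0_def step_bound_def)

lemma C_pos: "0 < C"
  using pos by (simp add: C_def H_def add_pos_pos)

lemma gradient_stability:
  assumes M: "1 \<le> Mx" "1 \<le> My" and mesh: "time_mesh T N t"
    and P: "compl_kernels \<alpha> (\<alpha> / 2) N t P"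
    and u: "scheme_solution \<alpha> (\<alpha> / 2) xl xr yl yr p p1 p2 p3 p4 b3 Mx My N t \<phi> f u"
    and step: "\<And>k. 1 \<le> k \<Longrightarrow> k \<le> N \<Longrightarrow> tau t k \<le> \<tau>0"
    and n: "1 \<le> n" "n \<le> N"
    and Q: "\<And>k. 1 \<le> k \<Longrightarrow> k \<le> n \<Longrightarrow> (\<Sum>j=1..k. P k (k - j) * grad_norm xl xr yl yr Mx My
      (grid_fun xl xr yl yr Mx My (\<lambda>x y. f x y (t_off (\<alpha> / 2) t j)))) \<le> Q"
  shows "grad_norm xl xr yl yr Mx My (u n) \<le> C * (grad_norm xl xr yl yr Mx My (u 0) + Q)"
proof -
  interpret T: alikhanov_mesh \<alpha> T N t using \<alpha> mesh by unfold_locales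
  interpret S: space_mesh xl xr yl yr Mx My using box M by unfold_locales
  define F where "F j = grid_fun xl xr yl yr Mx My (\<lambda>x y. f x y (T.\<sigma> j))" for j
  let ?w = "\<lambda>e s. S.eweight (\<lambda>x y. p1 x y s) (\<lambda>x y. p2 x y s) e"
  have \<sigma>: "T.\<sigma> m \<in> {0..T}" if "1 \<le> m" "m \<le> N" for m
  proof -
    have "0 \<le> t (m - 1)" "t m \<le> T" using T.t_le[of 0 "m - 1"] T.t_le[of m N] that by (auto simp: T.t_N)
    with T.sigma_bounds[OF that] show ?thesis by simp
  qed
  have interior: "node xl xr Mx (real i) \<in> {xl<..<xr}" if "1 \<le> i" "i < Mx" for i
    using that box by (intro node_in) auto
  have interior': "node yl yr My (real j) \<in> {yl<..<yr}" if "1 \<le> j" "j < My" for j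
    using that box by (intro node_in) auto
  have half: "node xl xr Mx (real i + 1 / 2) \<in> {xl<..<xr}" if "i \<le> Mx - 1" for i
    using that box M by (intro node_in) auto
  have half': "node yl yr My (real j + 1 / 2) \<in> {yl<..<yr}" if "j \<le> My - 1" for j
    using that box M by (intro node_in) auto
  have edge: "(\<exists>x\<in>{xl<..<xr}. \<exists>y\<in>{yl<..<yr}. \<forall>s. ?w e s = p1 x y s)
      \<or> (\<exists>x\<in>{xl<..<xr}. \<exists>y\<in>{yl<..<yr}. \<forall>s. ?w e s = p2 x y s)" if e: "e \<in> S.edges" for e
  proof (cases e)
    case (Inl q)
    obtain i j where q: "q = (i, j)" by (cases q)
    with e Inl have "i \<le> Mx - 1" "1 \<le> j" "j < My" using M by (auto simp: S.edges_def)
    then show ?thesis using half[of i] interior'[of j] unfolding Inl q S.eweight.simps by blast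
  next
    case (Inr q)
    obtain i j where q: "q = (i, j)" by (cases q)
    with e Inr have "1 \<le> i" "i < Mx" "j \<le> My - 1" using M by (auto simp: S.edges_def)
    then show ?thesis using interior[of i] half'[of j] unfolding Inr q S.eweight.simps by blast
  qed
  have bd: "S.zero_bd (u k)" if "k \<le> N" for k
    using u that by (auto simp: scheme_solution_def S.zero_bd_def)
  have "L2_set (S.egrad (u n)) S.edges
      \<le> 2 * H * sqrt (B / c) * L2_set (S.egrad (u 0)) S.edges + 8 * H\<^sup>2 * (B / c) * Q"
  proof (rule T.weighted_stability[OF P S.finite_edges pos(1,2) K_nonneg,
        where w = ?w and F = "\<lambda>j. S.egrad (F j)"])
    show "c \<le> ?w e s \<and> ?w e s \<le> B" if "e \<in> S.edges" "0 \<le> s" "s \<le> T" for e s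
      using edge[OF that(1)] p12_bounds[of _ _ s] that(2,3) by fastforce
    show "?w e s \<le> ?w e r" if "e \<in> S.edges" "0 \<le> r" "r \<le> s" "s \<le> T" for e r s
      using edge[OF that(1)] p12_dec[of _ _ r s] that(2-) by fastforce
    show "(\<Sum>e\<in>S.edges. ?w e (T.\<sigma> m) * T.D (\<lambda>k. S.egrad (u k) e) m *
          ((1 - \<alpha> / 2) * S.egrad (u m) e + \<alpha> / 2 * S.egrad (u (m - 1)) e))
        \<le> K * (\<Sum>e\<in>S.edges. ((1 - \<alpha> / 2) * S.egrad (u m) e + \<alpha> / 2 * S.egrad (u (m - 1)) e)\<^sup>2)
          + (\<Sum>e\<in>S.edges. ?w e (T.\<sigma> m) * S.egrad (F m) e *
              ((1 - \<alpha> / 2) * S.egrad (u m) e + \<alpha> / 2 * S.egrad (u (m - 1)) e))"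
      if m: "1 \<le> m" "m \<le> N" for m
    proof -
      define d where "d i j = T.D (\<lambda>k. u k i j) m" for i j
      define v where "v i j = (1 - \<alpha> / 2) * u m i j + \<alpha> / 2 * u (m - 1) i j" for i j
      have gv: "S.egrad v e = (1 - \<alpha> / 2) * S.egrad (u m) e + \<alpha> / 2 * S.egrad (u (m - 1)) e" for e
        unfolding v_def by (rule S.egrad_linear)
      have gd: "S.egrad d e = T.D (\<lambda>k. S.egrad (u k) e) m" for e
      proof -
        have "S.egrad (\<lambda>i j. u k i j - u (k - 1) i j) e = S.egrad (u k) e - S.egrad (u (k - 1)) e" for k
          using S.egrad_linear[of 1 "u k" "-1" "u (k - 1)" e] by simp
        then show ?thesis
          unfolding d_def frac_diff_def by (simp add: S.egrad_sum)
      qed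
      have "(\<Sum>e\<in>S.edges. ?w e (T.\<sigma> m) * S.egrad d e * S.egrad v e)
        \<le> B * b\<^sup>2 * (1 + (xr - xl)\<^sup>2) * (\<Sum>e\<in>S.edges. (S.egrad v e)\<^sup>2)
          + (\<Sum>e\<in>S.edges. ?w e (T.\<sigma> m) * S.egrad (F m) e * S.egrad v e)"
      proof (rule S.energy_inequality)
        show "S.zero_bd d"
          unfolding S.zero_bd_def
        proof (intro allI impI)
          fix i j assume "i \<le> Mx \<and> j \<le> My \<and> (i = 0 \<or> i = Mx \<or> j = 0 \<or> j = My)"
          then have "u k i j = 0" if "k \<le> N" for k
            using bd[OF that] unfolding S.zero_bd_def by blast
          then show "d i j = 0" using m unfolding d_def frac_diff_def by (intro sum.neutral) auto
        qed
        show "S.zero_bd (F m)" by (auto simp: S.zero_bd_def F_def grid_fun_def)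
        show "S.zero_bd v"
          unfolding S.zero_bd_def
        proof (intro allI impI)
          fix i j assume "i \<le> Mx \<and> j \<le> My \<and> (i = 0 \<or> i = Mx \<or> j = 0 \<or> j = My)"
          then have "u k i j = 0" if "k \<le> N" for k
            using bd[OF that] unfolding S.zero_bd_def by blast
          then show "v i j = 0" using m by (simp add: v_def)
        qed
        fix i j assume ij: "1 \<le> i" "i < Mx" "1 \<le> j" "j < My"
        show "0 < p (node xl xr Mx (real i)) (node yl yr My (real j)) (T.\<sigma> m) \<and>
            p (node xl xr Mx (real i)) (node yl yr My (real j)) (T.\<sigma> m) \<le> B"
          by (rule p_bounds[OF interior[OF ij(1,2)] interior'[OF ij(3,4)] \<sigma>[OF m]])
        show "\<bar>p3 (node xl xr Mx (real i)) (node yl yr My (real j)) (T.\<sigma> m)\<bar> \<le> b \<and>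
            \<bar>p4 (node xl xr Mx (real i)) (node yl yr My (real j)) (T.\<sigma> m)\<bar> \<le> b \<and>
            \<bar>b3 (node xl xr Mx (real i)) (node yl yr My (real j)) (T.\<sigma> m)\<bar> \<le> b"
          by (rule low_bounds[OF interior[OF ij(1,2)] interior'[OF ij(3,4)] \<sigma>[OF m]])
        show "d i j = A_h xl xr yl yr Mx My (\<lambda>x y. p x y (T.\<sigma> m)) (\<lambda>x y. p1 x y (T.\<sigma> m)) (\<lambda>x y. p2 x y (T.\<sigma> m))
            (\<lambda>x y. p3 x y (T.\<sigma> m)) (\<lambda>x y. p4 x y (T.\<sigma> m)) (\<lambda>x y. b3 x y (T.\<sigma> m)) v i j + F m i j"
        proof -
          have Fm: "F m i j = f (node xl xr Mx (real i)) (node yl yr My (real j)) (T.\<sigma> m)"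
            using ij by (simp add: F_def grid_fun_def)
          have vm: "v = (\<lambda>i j. (1 - \<alpha> / 2) * u m i j + \<alpha> / 2 * u (m - 1) i j)"
            by (intro ext) (simp add: v_def)
          have "1 \<le> m \<and> m \<le> N \<and> 1 \<le> i \<and> i < Mx \<and> 1 \<le> j \<and> j < My" using m ij by simp
          from u[unfolded scheme_solution_def Let_def, THEN conjunct1, rule_format, OF this]
          show ?thesis unfolding d_def Fm vm .
        qed
      qed (use pos in auto)
      then show ?thesis by (simp only: gv gd K_def)
    qed
    show "(\<Sum>j=1..k. P k (k - j) * L2_set (S.egrad (F j)) S.edges) \<le> Q" if "1 \<le> k" "k \<le> n" for k
      using Q[OF that] by (simp add: F_def S.grad_norm_L2)
  qed (use step n in \<open>auto simp: \<tau>0_def H_def\<close>)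
  also have "\<dots> \<le> C * (L2_set (S.egrad (u 0)) S.edges + Q)"
  proof -
    have "0 \<le> P 1 (1 - 1) * L2_set (S.egrad (F 1)) S.edges"
      using T.P_nonneg[OF P, of 1 1] n by (intro mult_nonneg_nonneg) auto
    then have Q0: "0 \<le> Q" using Q[of 1] n by (simp add: F_def S.grad_norm_L2)
    have C2: "0 \<le> 2 * H * sqrt (B / c)" "0 \<le> 8 * H\<^sup>2 * (B / c)"
      using pos by (auto simp: H_def)
    have lin: "r * X + s * Q \<le> (r + s) * (X + Q)" if "0 \<le> r" "0 \<le> s" "0 \<le> X" "0 \<le> Q" for r s X Q :: real
      using that by (simp add: algebra_simps)
    show ?thesis unfolding C_def by (rule lin[OF C2 L2_set_nonneg Q0])
  qed
  finally show ?thesis by (simp only: S.grad_norm_L2)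
qed

end

lemma (in alikhanov_mesh) compl_sum_le_Max:
  assumes P: "compl_kernels \<alpha> (\<alpha> / 2) N t P" and k: "1 \<le> k" "k \<le> n" "n \<le> N" and F: "\<And>j. 0 \<le> F j"
  shows "(\<Sum>j=1..k. P k (k - j) * F j) \<le> Gamma (1 - \<alpha>) * Max ((\<lambda>j. t j powr \<alpha> * F j) ` {1..n})"
proof -
  let ?M = "Max ((\<lambda>j. t j powr \<alpha> * F j) ` {1..n})"
  have le: "t j powr \<alpha> * F j \<le> ?M" if "j \<in> {1..n}" for j
    using that by (intro Max_ge) auto
  have M0: "0 \<le> ?M" 
  proof (rule order_trans)
    show "0 \<le> t 1 powr \<alpha> * F 1" using F by simp
    show "t 1 powr \<alpha> * F 1 \<le> ?M" using k by (intro le) auto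
  qed
  have "(\<Sum>j=1..k. P k (k - j) * F j) \<le> (\<Sum>j=1..k. P k (k - j) * (t j powr - \<alpha> * ?M))"
  proof (intro sum_mono mult_left_mono)
    fix j assume j: "j \<in> {1..k}"
    have "0 < t j" using t_less[of 0 j] j k by auto
    then have "t j powr - \<alpha> * t j powr \<alpha> = 1" by (simp add: powr_add[symmetric])
    then have "F j = t j powr - \<alpha> * (t j powr \<alpha> * F j)" by (simp add: mult.assoc[symmetric])
    also have "\<dots> \<le> t j powr - \<alpha> * ?M" using le[of j] j k by (intro mult_left_mono) auto
    finally show "F j \<le> t j powr - \<alpha> * ?M" .
  qed (use P_nonneg[OF P] k in auto)
  also have "\<dots> = (\<Sum>j=1..k. P k (k - j) * t j powr - \<alpha>) * ?M"
    by (simp add: sum_distrib_right mult.assoc)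
  also have "\<dots> \<le> Gamma (1 - \<alpha>) * ?M"
    using compl_sum_powr[OF P, of k] k M0 by (intro mult_right_mono) auto
  finally show ?thesis .
qed

text \<open>The hypotheses say that the logarithmic derivative of \<open>a\<close> is at least \<open>- C\<close>.\<close>

lemma exp_div_decreasing:
  assumes a: "C1_time T a a'" and pos: "\<And>s. s \<in> {0..T} \<Longrightarrow> 0 < a s"
    and le: "\<And>s. s \<in> {0..T} \<Longrightarrow> - (C * a s) \<le> a' s" and rs: "0 \<le> r" "r \<le> s" "s \<le> T"
  shows "exp (- C * s) / a s \<le> exp (- C * r) / a r"
proof -
  have der: "(a has_real_derivative a' z) (at z within {0..T})" if "z \<in> {0..T}" for z
    using a that by (auto simp: C1_time_def)
  have "exp (C * r) * a r \<le> exp (C * s) * a s"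
  proof (rule DERIV_nonneg_imp_increasing_open[OF rs(2)])
    fix z assume z: "r < z" "z < s"
    have "(a has_real_derivative a' z) (at z)"
      using der[of z] at_within_interior[of z "{0..T}"] z rs by (simp add: interior_atLeastAtMost_real)
    then have "((\<lambda>z. exp (C * z) * a z) has_real_derivative exp (C * z) * (C * a z + a' z)) (at z)"
      by (auto intro!: derivative_eq_intros simp: algebra_simps)
    moreover have "0 \<le> exp (C * z) * (C * a z + a' z)"
      using le[of z] z rs by (intro mult_nonneg_nonneg) auto
    ultimately show "\<exists>y. ((\<lambda>z. exp (C * z) * a z) has_real_derivative y) (at z) \<and> 0 \<le> y" by blast
  next
    have "continuous_on {0..T} a"
      using der by (intro DERIV_continuous_on) auto
    then have "continuous_on {r..s} a" by (rule continuous_on_subset) (use rs in auto)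
    then show "continuous_on {r..s} (\<lambda>z. exp (C * z) * a z)" by (intro continuous_intros)
  qed
  moreover have "0 < a r" "0 < a s" using pos rs by auto
  ultimately show ?thesis by (simp add: exp_minus field_simps)
qed

theorem theorem3p2:
  fixes \<alpha> \<beta> \<theta> T xl xr yl yr Cp C\<^sub>1 C\<^sub>2 C\<^sub>3 :: real
    and Ct Ch :: "nat \<Rightarrow> real"
    and \<Omega> :: "(real \<times> real) set"
    and d :: "real \<Rightarrow> real \<Rightarrow> real"
    and a1 a2 a1t a2t b1 b2 b3 p p1 p2 p3 p4 :: "real \<Rightarrow> real \<Rightarrow> real \<Rightarrow> real"
  assumes "0 < \<alpha>" "\<alpha> < 1" "\<beta> = \<alpha>" "\<theta> = \<alpha> / 2"
    and "xl < xr" "yl < yr" "T > 0"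
    and "\<Omega> = {xl<..<xr} \<times> {yl<..<yr}"
    and "\<forall>(x, y) \<in> \<Omega>. d x y > 0" "continuous_on \<Omega> (\<lambda>(x, y). d x y)"
    and "p = (\<lambda>x y s. d x y * exp (- Cp * s) / (a1 x y s * a2 x y s))"
    and "p1 = (\<lambda>x y s. p x y s * a1 x y s)"
    and "p2 = (\<lambda>x y s. p x y s * a2 x y s)"
    and "p3 = (\<lambda>x y s. b1 x y s - inverse (p x y s) * deriv (\<lambda>\<xi>. p1 \<xi> y s) x)"
    and "p4 = (\<lambda>x y s. b2 x y s - inverse (p x y s) * deriv (\<lambda>\<eta>. p2 x \<eta> s) y)"
    and "\<forall>s\<in>{0..T}. Ck_on 3 (\<lambda>(x, y). a1 x y s) \<Omega> \<and> Ck_on 3 (\<lambda>(x, y). a2 x y s) \<Omega>"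
    and "C\<^sub>1 > 0" "C\<^sub>2 > 0" "C\<^sub>3 > 0"
    and "\<forall>(x, y) \<in> \<Omega>. \<forall>s\<in>{0..T}. \<bar>b1 x y s\<bar> \<le> C\<^sub>1 \<and> \<bar>b2 x y s\<bar> \<le> C\<^sub>2 \<and> \<bar>b3 x y s\<bar> \<le> C\<^sub>3"
    and "\<forall>l\<le>4. Ct l > 0 \<and> Ch l > 0"
    and "\<forall>(x, y) \<in> \<Omega>. \<forall>s\<in>{0..T}.
           Ct 0 \<le> \<bar>p x y s\<bar> \<and> \<bar>p x y s\<bar> \<le> Ch 0 \<and>
           Ct 1 \<le> \<bar>p1 x y s\<bar> \<and> \<bar>p1 x y s\<bar> \<le> Ch 1 \<and>
           Ct 2 \<le> \<bar>p2 x y s\<bar> \<and> \<bar>p2 x y s\<bar> \<le> Ch 2 \<and>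
           Ct 3 \<le> \<bar>p3 x y s\<bar> \<and> \<bar>p3 x y s\<bar> \<le> Ch 3 \<and>
           Ct 4 \<le> \<bar>p4 x y s\<bar> \<and> \<bar>p4 x y s\<bar> \<le> Ch 4"
    and "\<forall>(x, y) \<in> \<Omega>. \<forall>s\<in>{0..T}. a1 x y s > 0 \<and> a2 x y s > 0"
    and "\<forall>(x, y) \<in> \<Omega>. C1_time T (a1 x y) (a1t x y) \<and> C1_time T (a2 x y) (a2t x y)"
    and "Cp > 0"
    and "\<forall>(x, y) \<in> \<Omega>. \<forall>s\<in>{0..T}. \<bar>a1t x y s / a1 x y s\<bar> + \<bar>a2t x y s / a2 x y s\<bar> \<le> Cp"
  shows "\<exists>\<tau>\<^sub>0>0.
    unconditionally_stable \<beta> \<theta> xl xr yl yr T p p1 p2 p3 p4 b3 \<tau>\<^sub>0 \<and>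
    (\<exists>C>0. \<exists>C'>0. \<forall>Mx My N t P \<phi> f u.
       1 \<le> Mx \<and> 1 \<le> My \<and> time_mesh T N t \<and>
       compl_kernels \<beta> \<theta> N t P \<and>
       scheme_solution \<beta> \<theta> xl xr yl yr p p1 p2 p3 p4 b3 Mx My N t \<phi> f u \<longrightarrow>
       (let nrm = grad_norm xl xr yl yr Mx My;
            F = (\<lambda>j. grid_fun xl xr yl yr Mx My (\<lambda>x y. f x y (t_off \<theta> t j)))
        in \<forall>n\<in>{1..N}.
          ((\<forall>k\<in>{1..N}. tau t k \<le> \<tau>\<^sub>0) \<longrightarrow>
            nrm (u n)
            \<le> C * (nrm (u 0) + Max ((\<lambda>k. \<Sum>j=1..k. P k (k - j) * nrm (F j)) ` {1..n}))) \<and>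
          C * (nrm (u 0) + Max ((\<lambda>k. \<Sum>j=1..k. P k (k - j) * nrm (F j)) ` {1..n}))
            \<le> C' * (nrm (u 0) + Max ((\<lambda>k. t k powr \<alpha> * nrm (F k)) ` {1..n}))))"
proof -
  define c where "c = min (Ct 1) (Ct 2)"
  define B where "B = max (Ch 0) (max (Ch 1) (Ch 2))"
  define b where "b = max C\<^sub>3 (max (Ch 3) (Ch 4))"
  have in_\<Omega>: "(x, y) \<in> \<Omega>" if "x \<in> {xl<..<xr}" "y \<in> {yl<..<yr}" for x y
    using that assms(8) by simp
  have bounds: "Ct 0 \<le> \<bar>p x y s\<bar> \<and> \<bar>p x y s\<bar> \<le> Ch 0 \<and> Ct 1 \<le> \<bar>p1 x y s\<bar> \<and> \<bar>p1 x y s\<bar> \<le> Ch 1 \<and>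
      Ct 2 \<le> \<bar>p2 x y s\<bar> \<and> \<bar>p2 x y s\<bar> \<le> Ch 2 \<and> \<bar>p3 x y s\<bar> \<le> Ch 3 \<and> \<bar>p4 x y s\<bar> \<le> Ch 4 \<and>
      \<bar>b3 x y s\<bar> \<le> C\<^sub>3 \<and> 0 < a1 x y s \<and> 0 < a2 x y s \<and> 0 < d x y \<and>
      \<bar>a1t x y s / a1 x y s\<bar> + \<bar>a2t x y s / a2 x y s\<bar> \<le> Cp"
    if "x \<in> {xl<..<xr}" "y \<in> {yl<..<yr}" "s \<in> {0..T}" for x y s
    using in_\<Omega>[OF that(1,2)] that(3) assms(9) assms(20) assms(22) assms(23) assms(26) by fast
  have dec: "p1 x y s \<le> p1 x y r \<and> p2 x y s \<le> p2 x y r"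
    if xy: "x \<in> {xl<..<xr}" "y \<in> {yl<..<yr}" and rs: "0 \<le> r" "r \<le> s" "s \<le> T" for x y r s
  proof -
    note bd = bounds[OF xy]
    have C1: "C1_time T (a1 x y) (a1t x y)" "C1_time T (a2 x y) (a2t x y)"
      using in_\<Omega>[OF xy] assms(24) by fast+
    have low: "- (Cp * a1 x y z) \<le> a1t x y z" "- (Cp * a2 x y z) \<le> a2t x y z" if z: "z \<in> {0..T}" for z
    proof -
      have a: "0 < a1 x y z" "0 < a2 x y z" using bd[OF z] by auto
      have "- Cp \<le> a1t x y z / a1 x y z" "- Cp \<le> a2t x y z / a2 x y z" using bd[OF z] by linarith+
      then show "- (Cp * a1 x y z) \<le> a1t x y z" "- (Cp * a2 x y z) \<le> a2t x y z"
        using a by (simp_all add: pos_le_divide_eq)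
    qed
    \<comment> \<open>\<open>p1\<close> and \<open>p2\<close> are \<open>d\<close> times \<open>exp (- Cp * s) / a2\<close> and \<open>exp (- Cp * s) / a1\<close>\<close>
    have e1: "exp (- Cp * s) / a1 x y s \<le> exp (- Cp * r) / a1 x y r"
      using C1(1) _ low(1) rs by (rule exp_div_decreasing) (use bd in auto)
    have e2: "exp (- Cp * s) / a2 x y s \<le> exp (- Cp * r) / a2 x y r"
      using C1(2) _ low(2) rs by (rule exp_div_decreasing) (use bd in auto)
    have p12: "p1 x y z = d x y * (exp (- Cp * z) / a2 x y z)" "p2 x y z = d x y * (exp (- Cp * z) / a1 x y z)"
      if "z \<in> {0..T}" for z
      using bd[OF that] by (simp_all add: assms(11-13))
    have rsd: "r \<in> {0..T}" "s \<in> {0..T}" "0 \<le> d x y" using rs bd[of s] by auto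
    show ?thesis
      unfolding p12[OF rsd(1)] p12[OF rsd(2)]
      using mult_left_mono[OF e1 rsd(3)] mult_left_mono[OF e2 rsd(3)] by simp
  qed
  interpret C: parabolic_coefficients \<alpha> T xl xr yl yr c B b p p1 p2 p3 p4 b3
  proof
    show "0 < c" "0 < B" "0 \<le> b"
      using assms(21)[rule_format, of 0] assms(21)[rule_format, of 1] assms(21)[rule_format, of 2] assms(19)
      by (auto simp: c_def B_def b_def)
  next
    fix x y s assume xys: "x \<in> {xl<..<xr}" "y \<in> {yl<..<yr}" "s \<in> {0..T}"
    note bd = bounds[OF xys]
    have "0 < p x y s" using bd by (simp add: assms(11))
    then show "0 < p x y s \<and> p x y s \<le> B" using bd unfolding B_def by linarith
    have "0 < p1 x y s" "0 < p2 x y s" using bd \<open>0 < p x y s\<close> by (simp_all add: assms(12,13))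
    then show "c \<le> p1 x y s \<and> p1 x y s \<le> B \<and> c \<le> p2 x y s \<and> p2 x y s \<le> B"
      using bd unfolding B_def c_def by linarith
    show "\<bar>p3 x y s\<bar> \<le> b \<and> \<bar>p4 x y s\<bar> \<le> b \<and> \<bar>b3 x y s\<bar> \<le> b"
      using bd unfolding b_def by linarith
  qed (use assms(1,2,5,6) dec in auto)
  have G: "0 < Gamma (1 - \<alpha>)" using assms(2) by (simp add: Gamma_real_pos)
  define C' where "C' = C.C * (1 + Gamma (1 - \<alpha>))"
  have C': "0 < C'" using C.C_pos G by (simp add: C'_def)
  let ?nrm = "\<lambda>Mx My. grad_norm xl xr yl yr Mx My"
  let ?F = "\<lambda>Mx My t (f :: real \<Rightarrow> real \<Rightarrow> real \<Rightarrow> real) j.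
    grid_fun xl xr yl yr Mx My (\<lambda>x y. f x y (t_off (\<alpha> / 2) t j))"
  have nrm0: "0 \<le> ?nrm Mx My v" if "1 \<le> Mx" "1 \<le> My" for Mx My v
  proof -
    interpret space_mesh xl xr yl yr Mx My using that assms(5,6) by unfold_locales
    show ?thesis by (simp add: grad_norm_L2)
  qed
  have first: "?nrm Mx My (u n) \<le> C.C * (?nrm Mx My (u 0)
      + Max ((\<lambda>k. \<Sum>j=1..k. P k (k - j) * ?nrm Mx My (?F Mx My t f j)) ` {1..n}))"
    if "1 \<le> Mx" "1 \<le> My" "time_mesh T N t" "compl_kernels \<alpha> (\<alpha> / 2) N t P"
      "scheme_solution \<alpha> (\<alpha> / 2) xl xr yl yr p p1 p2 p3 p4 b3 Mx My N t \<phi> f u"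
      "\<forall>k\<in>{1..N}. tau t k \<le> C.\<tau>0" "n \<in> {1..N}" for Mx My N t P \<phi> f u n
    by (rule C.gradient_stability[OF that(1-5)]) (use that in \<open>auto intro!: Max_ge\<close>)
  have second: "C.C * (?nrm Mx My w + Max ((\<lambda>k. \<Sum>j=1..k. P k (k - j) * ?nrm Mx My (F j)) ` {1..n}))
      \<le> C' * (?nrm Mx My w + Max ((\<lambda>k. t k powr \<alpha> * ?nrm Mx My (F k)) ` {1..n}))"
    if M: "1 \<le> Mx" "1 \<le> My" and mesh: "time_mesh T N t" and P: "compl_kernels \<alpha> (\<alpha> / 2) N t P"
      and n: "n \<in> {1..N}" for Mx My N t P w F n
  proof -
    interpret alikhanov_mesh \<alpha> T N t using assms(1,2) mesh by unfold_locales
    define R where "R = Max ((\<lambda>k. t k powr \<alpha> * ?nrm Mx My (F k)) ` {1..n})"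
    define S where "S = Max ((\<lambda>k. \<Sum>j=1..k. P k (k - j) * ?nrm Mx My (F j)) ` {1..n})"
    have "S \<in> (\<lambda>k. \<Sum>j=1..k. P k (k - j) * ?nrm Mx My (F j)) ` {1..n}"
      unfolding S_def using n by (intro Max_in) auto
    then obtain k where "1 \<le> k" "k \<le> n" "S = (\<Sum>j=1..k. P k (k - j) * ?nrm Mx My (F j))" by auto
    then have S: "S \<le> Gamma (1 - \<alpha>) * R"
      unfolding R_def using compl_sum_le_Max[OF P, of k n "\<lambda>j. ?nrm Mx My (F j)"] nrm0[OF M] n by simp
    have "0 \<le> t 1 powr \<alpha> * ?nrm Mx My (F 1)" using nrm0[OF M] by simp
    also have "\<dots> \<le> R" unfolding R_def using n by (intro Max_ge) auto
    finally have R: "0 \<le> R" .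
    have "0 \<le> Gamma (1 - \<alpha>) * ?nrm Mx My w" using G nrm0[OF M, of w] by simp
    with S R have "?nrm Mx My w + S \<le> (1 + Gamma (1 - \<alpha>)) * (?nrm Mx My w + R)"
      unfolding distrib_left distrib_right by linarith
    then have "C.C * (?nrm Mx My w + S) \<le> C.C * ((1 + Gamma (1 - \<alpha>)) * (?nrm Mx My w + R))"
      using C.C_pos by (intro mult_left_mono) auto
    then show ?thesis by (simp only: R_def S_def C'_def mult.assoc)
  qed
  have "unconditionally_stable \<beta> \<theta> xl xr yl yr T p p1 p2 p3 p4 b3 C.\<tau>0"
    unfolding unconditionally_stable_def assms(3,4)
  proof (intro exI[of _ C'] conjI C' allI impI ballI)
    fix Mx My N t \<phi> \<psi> f g u v n
    assume *: "1 \<le> Mx \<and> 1 \<le> My \<and> time_mesh T N t \<and> (\<forall>k\<in>{1..N}. tau t k \<le> C.\<tau>0) \<and>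
       scheme_solution \<alpha> (\<alpha> / 2) xl xr yl yr p p1 p2 p3 p4 b3 Mx My N t \<phi> f u \<and>
       scheme_solution \<alpha> (\<alpha> / 2) xl xr yl yr p p1 p2 p3 p4 b3 Mx My N t \<psi> g v" and n: "n \<in> {1..N}"
    interpret alikhanov_mesh \<alpha> T N t using assms(1,2) * by unfold_locales auto
    \<comment> \<open>the stability estimate does not mention complementary kernels, so they have to be constructed\<close>
    define P where "P = compl_kernel (alik_A \<alpha> (\<alpha> / 2) t)"
    have P: "compl_kernels \<alpha> (\<alpha> / 2) N t P"
      unfolding P_def
    proof (rule compl_kernels_exist)
      show "alik_A \<alpha> (\<alpha> / 2) t j 0 \<noteq> 0" if "1 \<le> j" "j \<le> N" for j
        using A_pos[of j j] that by simp
    qed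
    from * have sol: "scheme_solution \<alpha> (\<alpha> / 2) xl xr yl yr p p1 p2 p3 p4 b3 Mx My N t
        (\<lambda>x y. \<phi> x y - \<psi> x y) (\<lambda>x y s. f x y s - g x y s) (\<lambda>n i j. u n i j - v n i j)"
      by (intro scheme_solution_diff) auto
    show "?nrm Mx My (\<lambda>i j. u n i j - v n i j) \<le> C' * (?nrm Mx My (\<lambda>i j. u 0 i j - v 0 i j) +
        Max ((\<lambda>k. t k powr \<alpha> * ?nrm Mx My (grid_fun xl xr yl yr Mx My
          (\<lambda>x y. f x y (t_off (\<alpha> / 2) t k) - g x y (t_off (\<alpha> / 2) t k)))) ` {1..n}))"
      by (rule order_trans[OF first[OF _ _ _ P sol _ n] second[OF _ _ _ P n]]) (use * in auto)
  qed
  moreover have "\<forall>Mx My N t P \<phi> f u.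
       1 \<le> Mx \<and> 1 \<le> My \<and> time_mesh T N t \<and> compl_kernels \<beta> \<theta> N t P \<and>
       scheme_solution \<beta> \<theta> xl xr yl yr p p1 p2 p3 p4 b3 Mx My N t \<phi> f u \<longrightarrow>
       (let nrm = grad_norm xl xr yl yr Mx My;
            F = (\<lambda>j. grid_fun xl xr yl yr Mx My (\<lambda>x y. f x y (t_off \<theta> t j)))
        in \<forall>n\<in>{1..N}.
          ((\<forall>k\<in>{1..N}. tau t k \<le> C.\<tau>0) \<longrightarrow>
            nrm (u n)
            \<le> C.C * (nrm (u 0) + Max ((\<lambda>k. \<Sum>j=1..k. P k (k - j) * nrm (F j)) ` {1..n}))) \<and>
          C.C * (nrm (u 0) + Max ((\<lambda>k. \<Sum>j=1..k. P k (k - j) * nrm (F j)) ` {1..n}))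
            \<le> C' * (nrm (u 0) + Max ((\<lambda>k. t k powr \<alpha> * nrm (F k)) ` {1..n})))"
    unfolding Let_def assms(3,4)
  proof (intro allI impI ballI conjI)
    fix Mx My N t P \<phi> f u n
    assume *: "1 \<le> Mx \<and> 1 \<le> My \<and> time_mesh T N t \<and> compl_kernels \<alpha> (\<alpha> / 2) N t P \<and>
       scheme_solution \<alpha> (\<alpha> / 2) xl xr yl yr p p1 p2 p3 p4 b3 Mx My N t \<phi> f u" and n: "n \<in> {1..N}"
    show "C.C * (?nrm Mx My (u 0) + Max ((\<lambda>k. \<Sum>j=1..k. P k (k - j) * ?nrm Mx My (?F Mx My t f j)) ` {1..n}))
      \<le> C' * (?nrm Mx My (u 0) + Max ((\<lambda>k. t k powr \<alpha> * ?nrm Mx My (?F Mx My t f k)) ` {1..n}))"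
      using * n by (intro second[where N = N]) auto
    assume "\<forall>k\<in>{1..N}. tau t k \<le> C.\<tau>0"
    with * n show "?nrm Mx My (u n) \<le> C.C * (?nrm Mx My (u 0)
      + Max ((\<lambda>k. \<Sum>j=1..k. P k (k - j) * ?nrm Mx My (?F Mx My t f j)) ` {1..n}))"
      by (intro first[where N = N and \<phi> = \<phi>]) auto
  qed
  ultimately show ?thesis
    using C.\<tau>0_pos C.C_pos C' by blast
qed

end
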